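(* Let $d$ be a prime, $n,N_1,N_2\in\mathbb{N}$, $\omega\in\mathbb{C}$ a primitive $d$-th root of unity, and $W_1,W_2\in M_n(\mathbb{Z}_d)$. For $i=1,2$ let $\mu_i:\mathcal{G}_d^n(W_i)\to GL(\mathbb{C}^{N_i})$, $\mu_i(a,p,x)=a\,\omega^p\,\tau_i(x)$, be a polar commutator representation. If $\Omega_i=W_i-W_i^T$ has full rank over $\mathbb{Z}_d$ for $i=1,2$, then there exists a group isomorphism $\phi:\mathcal{G}_d^n(W_1)\to\mathcal{G}_d^n(W_2)$. Furthermore, if $\phi$ is such an isomorphism, the representations $\mu_1$ and $\mu_2\circ\phi$ have the same character, and there exists a set $B\subseteq\mathcal{G}_d^n(W_1)$ such that $\mu_1(B)$ is a set of Hermitian (respectively unitary) matrices spanning the complex vector space $M_{N_1}(\mathbb{C})$ and $\mu_2(\phi(g))$ is Hermitian (respectively unitary) for all $g\in B$, then $N_1=N_2=:N$ and there exists a unitary $S\in U(N)$ with $\mu_2(\phi(g))=S\mu_1(g)S^{-1}$ for all $g\in\mathcal{G}_d^n(W_1)$.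
   Context: Let $F\subset\mathbb{C}^\times$ be a fixed set of representatives of the quotient $\mathbb{C}^\times/\langle\omega\rangle$ with $1\in F$, and let $r:\mathbb{C}^\times\to F$, $u:\mathbb{C}^\times\to\mathbb{Z}_d$ be such that $a=r(a)\,\omega^{u(a)}$ for all $a\in\mathbb{C}^\times$. For $W\in M_n(\mathbb{Z}_d)$, the polar commutator group $\mathcal{G}_d^n(W)$ is the set $F\times\mathbb{Z}_d\times\mathbb{Z}_d^n$ with multiplication $(a,p,x)\cdot(b,q,y)=(r(ab),\,u(ab)+p+q+x^TWy,\,x+y)$. A polar commutator representation of $\mathcal{G}_d^n(W)$ in $\mathbb{C}^N$ is a map $\mu(a,p,x)=a\,\omega^p\,\tau(x)$, where $\tau:\mathbb{Z}_d^n\to GL(\mathbb{C}^N)$ is such that $\mu$ is an injective group homomorphism. The character of a representation is its trace. *)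

theory Defs
  imports Complex_Main "HOL-Algebra.Group" "Jordan_Normal_Form.Schur_Decomposition"
begin

text \<open>Z_d is represented by the integers {0..<d}; vectors in Z_d^n by functions
  nat => int with entries in {0..<d} at indices < n and 0 elsewhere;
  n x n matrices over Z_d by functions nat => nat => int (only entries i,j < n matter).\<close>

definition zd_vecs :: "int \<Rightarrow> nat \<Rightarrow> (nat \<Rightarrow> int) set" where
  "zd_vecs d n = {x. (\<forall>j<n. x j \<in> {0..<d}) \<and> (\<forall>j\<ge>n. x j = 0)}"

definition zd_mats :: "int \<Rightarrow> nat \<Rightarrow> (nat \<Rightarrow> nat \<Rightarrow> int) set" where
  "zd_mats d n = {W. \<forall>i<n. \<forall>j<n. W i j \<in> {0..<d}}"

definition bilin :: "int \<Rightarrow> nat \<Rightarrow> (nat \<Rightarrow> nat \<Rightarrow> int) \<Rightarrow> (nat \<Rightarrow> int) \<Rightarrow> (nat \<Rightarrow> int) \<Rightarrow> int" where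
  "bilin d n W x y = (\<Sum>i<n. \<Sum>j<n. x i * W i j * y j) mod d"

definition vadd :: "int \<Rightarrow> nat \<Rightarrow> (nat \<Rightarrow> int) \<Rightarrow> (nat \<Rightarrow> int) \<Rightarrow> (nat \<Rightarrow> int)" where
  "vadd d n x y = (\<lambda>j. if j < n then (x j + y j) mod d else 0)"

definition full_rank_mod :: "int \<Rightarrow> nat \<Rightarrow> (nat \<Rightarrow> nat \<Rightarrow> int) \<Rightarrow> bool" where
  "full_rank_mod d n M \<longleftrightarrow>
     (\<forall>x\<in>zd_vecs d n. (\<forall>i<n. (\<Sum>j<n. M i j * x j) mod d = 0) \<longrightarrow> (\<forall>j<n. x j = 0))"

definition Omega :: "int \<Rightarrow> (nat \<Rightarrow> nat \<Rightarrow> int) \<Rightarrow> (nat \<Rightarrow> nat \<Rightarrow> int)" where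
  "Omega d W = (\<lambda>i j. (W i j - W j i) mod d)"

definition prim_root :: "nat \<Rightarrow> complex \<Rightarrow> bool" where
  "prim_root d \<omega> \<longleftrightarrow> \<omega> ^ d = 1 \<and> (\<forall>k. 0 < k \<and> k < d \<longrightarrow> \<omega> ^ k \<noteq> 1)"

text \<open>F is a set of representatives of C^x / <omega> (each coset a<omega> meets F in exactly one point).\<close>
definition rep_set :: "complex \<Rightarrow> complex set \<Rightarrow> bool" where
  "rep_set \<omega> F \<longleftrightarrow> 0 \<notin> F \<and> (\<forall>a. a \<noteq> 0 \<longrightarrow> (\<exists>!f. f \<in> F \<and> (\<exists>k::nat. a = f * \<omega> ^ k)))"

definition polar_decomp :: "int \<Rightarrow> complex \<Rightarrow> complex set \<Rightarrow> (complex \<Rightarrow> complex) \<Rightarrow> (complex \<Rightarrow> int) \<Rightarrow> bool" where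
  "polar_decomp d \<omega> F r u \<longleftrightarrow>
     (\<forall>a. a \<noteq> 0 \<longrightarrow> r a \<in> F \<and> u a \<in> {0..<d} \<and> a = r a * \<omega> powi u a)"

definition polar_mult ::
  "int \<Rightarrow> nat \<Rightarrow> (nat \<Rightarrow> nat \<Rightarrow> int) \<Rightarrow> (complex \<Rightarrow> complex) \<Rightarrow> (complex \<Rightarrow> int)
    \<Rightarrow> complex \<times> int \<times> (nat \<Rightarrow> int) \<Rightarrow> complex \<times> int \<times> (nat \<Rightarrow> int) \<Rightarrow> complex \<times> int \<times> (nat \<Rightarrow> int)" where
  "polar_mult d n W r u g h =
     (case g of (a, p, x) \<Rightarrow> case h of (b, q, y) \<Rightarrow>
        (r (a * b), (u (a * b) + p + q + bilin d n W x y) mod d, vadd d n x y))"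

definition polar_grp ::
  "int \<Rightarrow> nat \<Rightarrow> (nat \<Rightarrow> nat \<Rightarrow> int) \<Rightarrow> complex set \<Rightarrow> (complex \<Rightarrow> complex) \<Rightarrow> (complex \<Rightarrow> int)
    \<Rightarrow> (complex \<times> int \<times> (nat \<Rightarrow> int)) monoid" where
  "polar_grp d n W F r u =
    \<lparr> carrier = F \<times> {0..<d} \<times> zd_vecs d n,
      monoid.mult = polar_mult d n W r u,
      one = (1, 0, (\<lambda>_. 0)) \<rparr>"

definition GL_mat :: "nat \<Rightarrow> complex mat monoid" where
  "GL_mat N = \<lparr> carrier = {A \<in> carrier_mat N N. invertible_mat A}, monoid.mult = (*), one = 1\<^sub>m N \<rparr>"

definition pcr_map :: "complex \<Rightarrow> ((nat \<Rightarrow> int) \<Rightarrow> complex mat) \<Rightarrow> complex \<times> int \<times> (nat \<Rightarrow> int) \<Rightarrow> complex mat" where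
  "pcr_map \<omega> \<tau> = (\<lambda>(a, p, x). (a * \<omega> powi p) \<cdot>\<^sub>m \<tau> x)"

definition polar_comm_rep ::
  "int \<Rightarrow> nat \<Rightarrow> (nat \<Rightarrow> nat \<Rightarrow> int) \<Rightarrow> complex set \<Rightarrow> (complex \<Rightarrow> complex) \<Rightarrow> (complex \<Rightarrow> int)
    \<Rightarrow> complex \<Rightarrow> nat \<Rightarrow> ((nat \<Rightarrow> int) \<Rightarrow> complex mat) \<Rightarrow> bool" where
  "polar_comm_rep d n W F r u \<omega> N \<tau> \<longleftrightarrow>
     (\<forall>x\<in>zd_vecs d n. \<tau> x \<in> carrier (GL_mat N)) \<and>
     pcr_map \<omega> \<tau> \<in> hom (polar_grp d n W F r u) (GL_mat N) \<and>
     inj_on (pcr_map \<omega> \<tau>) (carrier (polar_grp d n W F r u))"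

definition mat_trace :: "complex mat \<Rightarrow> complex" where
  "mat_trace A = (\<Sum>i<dim_row A. A $$ (i, i))"

definition hermitian_mat :: "complex mat \<Rightarrow> bool" where
  "hermitian_mat A \<longleftrightarrow> square_mat A \<and> mat_adjoint A = A"

definition unitary_mat :: "complex mat \<Rightarrow> bool" where
  "unitary_mat A \<longleftrightarrow> square_mat A \<and>
     A * mat_adjoint A = 1\<^sub>m (dim_row A) \<and> mat_adjoint A * A = 1\<^sub>m (dim_row A)"

definition spans_mat :: "nat \<Rightarrow> complex mat set \<Rightarrow> bool" where
  "spans_mat N X \<longleftrightarrow> X \<subseteq> carrier_mat N N \<and>
     (\<forall>A\<in>carrier_mat N N. \<exists>S c. finite S \<and> S \<subseteq> X \<and>
        (\<forall>i<N. \<forall>j<N. A $$ (i, j) = (\<Sum>M\<in>S. c M * M $$ (i, j))))"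

end

theory Submission
  imports Defs "HOL-Number_Theory.Cong"
begin

text \<open>
  Existence of \<open>\<phi>\<close>: a nondegenerate alternating form over \<open>\<int>\<^sub>d\<close> has a symplectic basis, obtained
  by repeatedly adding hyperbolic pairs; all dimension arguments are pigeonhole counts on the finite
  sets \<open>\<int>\<^sub>d\<^sup>m\<close>. In such a basis \<open>W\<close> differs from the standard matrix by a symmetric matrix \<open>D\<close>, and
  \<open>\<omega> ^ (x\<^sup>T D y)\<close> is the coboundary of \<open>\<zeta> ^ (x\<^sup>T D x)\<close> with \<open>\<zeta>\<^sup>2 = \<omega>\<close>.

  Unitary equivalence: let \<open>\<rho>\<^sub>1, \<rho>\<^sub>2\<close> be representations of a group with the same character, and
  write the matrix units as \<open>E\<^sub>p = \<Sum> c\<^sub>b \<rho>\<^sub>1 b\<close> with \<open>b \<in> B\<close>. Since adjoints of the \<open>\<rho>\<^sub>i b\<close> are again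
  values of \<open>\<rho>\<^sub>i\<close> at a common group element (\<open>b\<close> or its inverse), the matrices
  \<open>M\<^sub>p = \<Sum> c\<^sub>b \<rho>\<^sub>2 b\<close> are orthonormal for the trace inner product, hence a basis. Comparing traces
  against this basis shows that the linear map \<open>E\<^sub>p \<mapsto> M\<^sub>p\<close> sends \<open>\<rho>\<^sub>1 g\<close> to \<open>\<rho>\<^sub>2 g\<close> for all \<open>g\<close>, so the
  \<open>M\<^sub>p\<close> are again self-adjoint matrix units, and such a system is unitarily conjugate to the \<open>E\<^sub>p\<close>.
\<close>

section \<open>Matrix units and traces\<close>

lemma index_mult_mat_sum:
  assumes "A \<in> carrier_mat N N" "B \<in> carrier_mat N N" "i < N" "j < N"
  shows "(A * B) $$ (i, j) = (\<Sum>k<N. A $$ (i, k) * B $$ (k, j))"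
  using assms by (auto simp: scalar_prod_def lessThan_atLeast0)

lemma mat_adjoint_carrier [simp]:
  "A \<in> carrier_mat N M \<Longrightarrow> mat_adjoint A \<in> carrier_mat M N"
  by (auto simp: mat_adjoint_def mat_of_rows_def)

lemma dim_mat_adjoint [simp]:
  "dim_row (mat_adjoint A) = dim_col A" "dim_col (mat_adjoint A) = dim_row A"
  by (auto simp: mat_adjoint_def mat_of_rows_def)

lemma index_mat_adjoint:
  fixes A :: "complex mat"
  assumes "A \<in> carrier_mat N M" "i < M" "j < N"
  shows "mat_adjoint A $$ (i, j) = cnj (A $$ (j, i))"
  using assms by (auto simp: mat_adjoint_def mat_of_rows_def)

lemma mat_trace_mult:
  assumes "A \<in> carrier_mat N N" "B \<in> carrier_mat N N"
  shows "mat_trace (A * B) = (\<Sum>i<N. \<Sum>k<N. A $$ (i, k) * B $$ (k, i))"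
proof -
  have "mat_trace (A * B) = (\<Sum>i<N. (A * B) $$ (i, i))"
    using assms by (auto simp: mat_trace_def)
  also have "\<dots> = (\<Sum>i<N. \<Sum>k<N. A $$ (i, k) * B $$ (k, i))"
    using assms by (intro sum.cong refl index_mult_mat_sum) auto
  finally show ?thesis .
qed

text \<open>The index set consists of group elements rather than matrices, so that one family of
  coefficients can be used with two representations.\<close>

definition mat_lincomb ::
  "nat \<Rightarrow> ('g \<Rightarrow> complex mat) \<Rightarrow> 'g set \<Rightarrow> ('g \<Rightarrow> complex) \<Rightarrow> complex mat" where
  "mat_lincomb N f S c = mat N N (\<lambda>(i, j). \<Sum>g\<in>S. c g * f g $$ (i, j))"

lemma mat_lincomb_carrier [simp]: "mat_lincomb N f S c \<in> carrier_mat N N"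
  by (simp add: mat_lincomb_def)

lemma dim_mat_lincomb [simp]:
  "dim_row (mat_lincomb N f S c) = N" "dim_col (mat_lincomb N f S c) = N"
  by (simp_all add: mat_lincomb_def)

lemma index_mat_lincomb:
  "i < N \<Longrightarrow> j < N \<Longrightarrow> mat_lincomb N f S c $$ (i, j) = (\<Sum>g\<in>S. c g * f g $$ (i, j))"
  by (simp add: mat_lincomb_def)

lemma mat_lincomb_cong:
  assumes "\<And>g. g \<in> S \<Longrightarrow> f g = f' g" "\<And>g. g \<in> S \<Longrightarrow> c g = c' g"
  shows "mat_lincomb N f S c = mat_lincomb N f' S c'"
  unfolding mat_lincomb_def using assms by (auto intro!: cong_mat sum.cong)

text \<open>When both families are values of one homomorphism, each \<open>f g * f' h\<close> is
  again a value of it, so combinations of such values are closed under multiplication.\<close>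

lemma mat_lincomb_mult:
  assumes "\<And>g. g \<in> S \<Longrightarrow> f g \<in> carrier_mat N N" "\<And>g. g \<in> S' \<Longrightarrow> f' g \<in> carrier_mat N N"
  shows "mat_lincomb N f S c * mat_lincomb N f' S' c' =
    mat_lincomb N (\<lambda>(g, h). f g * f' h) (S \<times> S') (\<lambda>(g, h). c g * c' h)"
proof (rule eq_matI)
  fix i j assume "i < dim_row (mat_lincomb N (\<lambda>(g, h). f g * f' h) (S \<times> S') (\<lambda>(g, h). c g * c' h))"
    "j < dim_col (mat_lincomb N (\<lambda>(g, h). f g * f' h) (S \<times> S') (\<lambda>(g, h). c g * c' h))"
  then have ij: "i < N" "j < N" by (auto simp: mat_lincomb_def)
  have "(mat_lincomb N f S c * mat_lincomb N f' S' c') $$ (i, j) =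
      (\<Sum>k<N. \<Sum>g\<in>S. \<Sum>h\<in>S'. (c g * f g $$ (i, k)) * (c' h * f' h $$ (k, j)))"
    using ij by (subst index_mult_mat_sum[where N = N])
      (simp_all add: index_mat_lincomb sum_product)
  also have "\<dots> = (\<Sum>g\<in>S. \<Sum>h\<in>S'. \<Sum>k<N. (c g * f g $$ (i, k)) * (c' h * f' h $$ (k, j)))"
    by (subst sum.swap, rule sum.cong[OF refl], subst sum.swap) simp
  also have "\<dots> = (\<Sum>g\<in>S. \<Sum>h\<in>S'. (c g * c' h) * (f g * f' h) $$ (i, j))"
    using ij assms
    by (intro sum.cong refl) (simp add: index_mult_mat_sum[where N = N] sum_distrib_left mult_ac)
  finally show "(mat_lincomb N f S c * mat_lincomb N f' S' c') $$ (i, j) =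
      mat_lincomb N (\<lambda>(g, h). f g * f' h) (S \<times> S') (\<lambda>(g, h). c g * c' h) $$ (i, j)"
    using ij by (simp add: index_mat_lincomb sum.cartesian_product case_prod_beta)
qed (auto simp: mat_lincomb_def)

lemma mat_adjoint_lincomb:
  assumes "\<And>g. g \<in> S \<Longrightarrow> f g \<in> carrier_mat N N"
  shows "mat_adjoint (mat_lincomb N f S c) =
    mat_lincomb N (\<lambda>g. mat_adjoint (f g)) S (\<lambda>g. cnj (c g))"
proof (rule eq_matI)
  fix i j assume "i < dim_row (mat_lincomb N (\<lambda>g. mat_adjoint (f g)) S (\<lambda>g. cnj (c g)))"
    "j < dim_col (mat_lincomb N (\<lambda>g. mat_adjoint (f g)) S (\<lambda>g. cnj (c g)))"
  then have ij: "i < N" "j < N" by (auto simp: mat_lincomb_def)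
  then show "mat_adjoint (mat_lincomb N f S c) $$ (i, j) =
      mat_lincomb N (\<lambda>g. mat_adjoint (f g)) S (\<lambda>g. cnj (c g)) $$ (i, j)"
    using assms by (auto simp: index_mat_adjoint[where N = N and M = N] index_mat_lincomb
      intro!: sum.cong)
qed auto

lemma mat_trace_lincomb:
  assumes "\<And>g. g \<in> S \<Longrightarrow> f g \<in> carrier_mat N N"
  shows "mat_trace (mat_lincomb N f S c) = (\<Sum>g\<in>S. c g * mat_trace (f g))"
proof -
  have "mat_trace (mat_lincomb N f S c) = (\<Sum>i<N. \<Sum>g\<in>S. c g * f g $$ (i, i))"
    by (simp add: mat_trace_def mat_lincomb_def)
  also have "\<dots> = (\<Sum>g\<in>S. \<Sum>i<N. c g * f g $$ (i, i))"
    by (rule sum.swap)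
  also have "\<dots> = (\<Sum>g\<in>S. c g * mat_trace (f g))"
    using assms by (intro sum.cong refl) (auto simp: mat_trace_def sum_distrib_left)
  finally show ?thesis .
qed

lemma mat_trace_lincomb_mult:
  assumes "\<And>g. g \<in> S \<Longrightarrow> f g \<in> carrier_mat N N" "B \<in> carrier_mat N N"
  shows "mat_trace (mat_lincomb N f S c * B) = (\<Sum>g\<in>S. c g * mat_trace (f g * B))"
proof -
  have "mat_lincomb N f S c * B = mat_lincomb N (\<lambda>g. f g * B) S c"
  proof (rule eq_matI)
    fix i j assume "i < dim_row (mat_lincomb N (\<lambda>g. f g * B) S c)"
      "j < dim_col (mat_lincomb N (\<lambda>g. f g * B) S c)"
    then have ij: "i < N" "j < N" by (auto simp: mat_lincomb_def)
    have "(mat_lincomb N f S c * B) $$ (i, j) =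
        (\<Sum>k<N. \<Sum>g\<in>S. c g * (f g $$ (i, k) * B $$ (k, j)))"
      using ij assms(2) by (subst index_mult_mat_sum[where N = N])
        (simp_all add: index_mat_lincomb sum_distrib_right mult.assoc)
    also have "\<dots> = (\<Sum>g\<in>S. c g * (f g * B) $$ (i, j))"
      using ij assms by (subst sum.swap)
        (auto simp: index_mult_mat_sum[where N = N] sum_distrib_left intro!: sum.cong)
    finally show "(mat_lincomb N f S c * B) $$ (i, j) =
        mat_lincomb N (\<lambda>g. f g * B) S c $$ (i, j)"
      using ij by (simp add: index_mat_lincomb)
  qed (use assms in \<open>auto simp: mat_lincomb_def\<close>)
  then show ?thesis using mat_trace_lincomb[of S "\<lambda>g. f g * B" N c]
    assms by (metis mult_carrier_mat)
qed

section \<open>Elementary matrices and systems of matrix units\<close>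

abbreviation mat_indices :: "nat \<Rightarrow> (nat \<times> nat) set" where
  "mat_indices N \<equiv> {..<N} \<times> {..<N}"

definition elem_mat :: "nat \<Rightarrow> nat \<times> nat \<Rightarrow> complex mat" where
  "elem_mat N p = mat N N (\<lambda>q. if q = p then 1 else 0)"

lemma elem_mat_carrier [simp]: "elem_mat N p \<in> carrier_mat N N"
  by (simp add: elem_mat_def)

lemma index_elem_mat:
  "i < N \<Longrightarrow> j < N \<Longrightarrow> elem_mat N p $$ (i, j) = (if (i, j) = p then 1 else 0)"
  by (simp add: elem_mat_def)

lemma mat_lincomb_elem_mat:
  assumes "A \<in> carrier_mat N N"
  shows "mat_lincomb N (elem_mat N) (mat_indices N) (\<lambda>p. A $$ p) = A"
proof (rule eq_matI)
  fix i j assume "i < dim_row A" "j < dim_col A"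
  then have ij: "i < N" "j < N" using assms by auto
  then have "mat_lincomb N (elem_mat N) (mat_indices N) (\<lambda>p. A $$ p) $$ (i, j) =
      (\<Sum>p\<in>mat_indices N. if (i, j) = p then A $$ p else 0)"
    by (subst index_mat_lincomb) (auto simp: index_elem_mat simp del: sum.delta sum.delta' intro!: sum.cong)
  also have "\<dots> = A $$ (i, j)" using ij by (subst sum.delta') auto
  finally show "mat_lincomb N (elem_mat N) (mat_indices N) (\<lambda>p. A $$ p) $$ (i, j) = A $$ (i, j)" .
qed (use assms in \<open>auto simp: mat_lincomb_def\<close>)

lemma elem_mat_mult:
  assumes "i < N" "j < N" "k < N" "l < N"
  shows "elem_mat N (i, j) * elem_mat N (k, l) = (if j = k then elem_mat N (i, l) else 0\<^sub>m N N)"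
proof (rule eq_matI)
  fix a b assume "a < dim_row (if j = k then elem_mat N (i, l) else 0\<^sub>m N N)"
    "b < dim_col (if j = k then elem_mat N (i, l) else 0\<^sub>m N N)"
  then have ab: "a < N" "b < N" by (auto simp: elem_mat_def split: if_splits)
  have "(elem_mat N (i, j) * elem_mat N (k, l)) $$ (a, b) =
      (\<Sum>c<N. if c = j then (if a = i \<and> c = k \<and> b = l then 1 else 0) else 0)"
    using ab by (subst index_mult_mat_sum[where N = N])
      (auto simp: index_elem_mat intro!: sum.cong simp del: sum.delta)
  then show "(elem_mat N (i, j) * elem_mat N (k, l)) $$ (a, b) =
      (if j = k then elem_mat N (i, l) else 0\<^sub>m N N) $$ (a, b)"
    using ab assms by (auto simp: index_elem_mat)
qed (auto simp: elem_mat_def)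

lemma elem_mat_adjoint: "mat_adjoint (elem_mat N (i, j)) = elem_mat N (j, i)"
proof (rule eq_matI)
  fix a b assume "a < dim_row (elem_mat N (j, i))" "b < dim_col (elem_mat N (j, i))"
  then have "a < N" "b < N" by (auto simp: elem_mat_def)
  then show "mat_adjoint (elem_mat N (i, j)) $$ (a, b) = elem_mat N (j, i) $$ (a, b)"
    by (auto simp: index_mat_adjoint[OF elem_mat_carrier] index_elem_mat)
qed (auto simp: elem_mat_def)

text \<open>The columns of the intertwiner are the images of one vector under the elements
  \<open>M (i, 0)\<close>; that vector is a normalised column of the projection \<open>M (0, 0)\<close>.\<close>

lemma matrix_units_unitary:
  fixes M :: "nat \<times> nat \<Rightarrow> complex mat"
  assumes N: "N > 0"
    and car: "\<And>p. p \<in> mat_indices N \<Longrightarrow> M p \<in> carrier_mat N N"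
    and mult: "\<And>i j k l. i < N \<Longrightarrow> j < N \<Longrightarrow> k < N \<Longrightarrow> l < N \<Longrightarrow>
      M (i, j) * M (k, l) = (if j = k then M (i, l) else 0\<^sub>m N N)"
    and adj: "\<And>i j. i < N \<Longrightarrow> j < N \<Longrightarrow> mat_adjoint (M (i, j)) = M (j, i)"
    and tr: "mat_trace (M (0, 0)) \<noteq> 0"
  shows "\<exists>S \<in> carrier_mat N N. unitary_mat S \<and>
    (\<forall>A \<in> carrier_mat N N. mat_lincomb N M (mat_indices N) (\<lambda>p. A $$ p) = S * A * mat_adjoint S)"
proof -
  have "dim_row (M (0, 0)) = N" using car[of "(0, 0)"] N by auto
  \<comment> \<open>Column \<open>j\<close> of \<open>M (0, 0)\<close> is nonzero; it serves as the
    starting vector.\<close>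
  then obtain j where j: "j < N" "M (0, 0) $$ (j, j) \<noteq> 0"
    using tr unfolding mat_trace_def by (metis (no_types, lifting) lessThan_iff sum.neutral)
  \<comment> \<open>As \<open>M (0, a)\<close> is the adjoint of \<open>M (a, 0)\<close>, this inner
    product of columns is the \<open>(j, j)\<close> entry of
    \<open>M (0, a) * M (b, 0)\<close>.\<close>
  have inner: "(\<Sum>k<N. cnj (M (a, 0) $$ (k, j)) * M (b, 0) $$ (k, j)) =
      (if a = b then M (0, 0) $$ (j, j) else 0)" if ab: "a < N" "b < N" for a b
  proof -
    have "(M (0, a) * M (b, 0)) $$ (j, j) = (\<Sum>k<N. M (0, a) $$ (j, k) * M (b, 0) $$ (k, j))"
      using car ab j N by (intro index_mult_mat_sum) auto
    moreover have "M (0, a) $$ (j, k) = cnj (M (a, 0) $$ (k, j))" if "k < N" for k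
      using adj[of a 0] ab N j that car[of "(a, 0)"]
        index_mat_adjoint[of "M (a, 0)" N N j k] by auto
    ultimately show ?thesis using mult[of 0 a b 0] ab N j by auto
  qed
  \<comment> \<open>The common squared norm of these columns. It equals the diagonal entry chosen
    nonzero above, hence is positive.\<close>
  define R where "R = (\<Sum>k<N. (cmod (M (0, 0) $$ (k, j)))\<^sup>2)"
  have R: "M (0, 0) $$ (j, j) = of_real R"
    using inner[of 0 0] N by (simp add: R_def complex_norm_square mult.commute del: of_real_power)
  have "R \<ge> 0" by (simp add: R_def sum_nonneg)
  moreover have "R \<noteq> 0" using R j by auto
  ultimately have Rp: "R > 0" by simp
  define c where "c = complex_of_real (1 / sqrt R)"
  have cc: "cnj c * c * of_real R = 1"
    using Rp by (simp add: c_def flip: of_real_mult)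
  define S where "S = mat N N (\<lambda>(k, i). c * M (i, 0) $$ (k, j))"
  have Sc: "S \<in> carrier_mat N N" by (simp add: S_def)
  have S_index: "S $$ (k, i) = c * M (i, 0) $$ (k, j)" if "k < N" "i < N" for k i
    using that by (simp add: S_def)
  have Sa: "mat_adjoint S \<in> carrier_mat N N" using Sc by simp
  have SS: "mat_adjoint S * S = 1\<^sub>m N"
  proof (rule eq_matI)
    fix a b assume "a < dim_row (1\<^sub>m N)" "b < dim_col (1\<^sub>m N)"
    then have ab: "a < N" "b < N" by auto
    have "(mat_adjoint S * S) $$ (a, b) =
        (\<Sum>k<N. cnj (c * M (a, 0) $$ (k, j)) * (c * M (b, 0) $$ (k, j)))"
      using ab Sc Sa by (subst index_mult_mat_sum[where N = N])
        (auto simp: index_mat_adjoint[OF Sc] S_index intro!: sum.cong)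
    also have "\<dots> = (cnj c * c) * (\<Sum>k<N. cnj (M (a, 0) $$ (k, j)) * M (b, 0) $$ (k, j))"
      by (simp add: sum_distrib_left mult_ac)
    also have "\<dots> = (if a = b then 1 else 0)"
      using inner[OF ab] R cc by simp
    finally show "(mat_adjoint S * S) $$ (a, b) = 1\<^sub>m N $$ (a, b)" using ab by simp
  qed (use Sc Sa in auto)
  have SS': "S * mat_adjoint S = 1\<^sub>m N"
    by (rule mat_mult_left_right_inverse[OF Sa Sc SS])
  have "mat_lincomb N M (mat_indices N) (\<lambda>p. A $$ p) = S * A * mat_adjoint S"
    if A: "A \<in> carrier_mat N N" for A
  proof -
    let ?T = "mat_lincomb N M (mat_indices N) (\<lambda>p. A $$ p)"
    \<comment> \<open>\<open>M (a, b)\<close> sends column \<open>b\<close> of \<open>S\<close> to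
      column \<open>a\<close> and annihilates the other columns, just as the elementary matrix acts
      on the standard basis.\<close>
    have "?T * S = S * A"
    proof (rule eq_matI)
      fix k i assume "k < dim_row (S * A)" "i < dim_col (S * A)"
      then have ki: "k < N" "i < N" using Sc A by auto
      have MM: "(\<Sum>m<N. M (a, b) $$ (k, m) * M (i, 0) $$ (m, j)) =
          (if b = i then M (a, 0) $$ (k, j) else 0)" if "a < N" "b < N" for a b
      proof -
        have "(M (a, b) * M (i, 0)) $$ (k, j) = (\<Sum>m<N. M (a, b) $$ (k, m) * M (i, 0) $$ (m, j))"
          using that ki N car j by (intro index_mult_mat_sum) auto
        then show ?thesis using mult[of a b i 0] that ki N j by auto
      qed
      have "(?T * S) $$ (k, i) =
          (\<Sum>m<N. (\<Sum>p\<in>mat_indices N. A $$ p * M p $$ (k, m)) * (c * M (i, 0) $$ (m, j)))"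
        using ki Sc by (subst index_mult_mat_sum[where N = N])
          (auto simp: index_mat_lincomb S_index)
      also have "\<dots> = (\<Sum>m<N. \<Sum>p\<in>mat_indices N. c * A $$ p * (M p $$ (k, m) * M (i, 0) $$ (m, j)))"
        by (simp add: sum_distrib_left mult_ac)
      also have "\<dots> = (\<Sum>p\<in>mat_indices N. c * A $$ p * (\<Sum>m<N. M p $$ (k, m) * M (i, 0) $$ (m, j)))"
        by (subst sum.swap) (simp add: sum_distrib_left)
      also have "\<dots> = (\<Sum>a<N. \<Sum>b<N. c * A $$ (a, b) * (\<Sum>m<N. M (a, b) $$ (k, m) * M (i, 0) $$ (m, j)))"
        by (simp add: sum.cartesian_product case_prod_beta)
      also have "\<dots> = (\<Sum>a<N. \<Sum>b<N. if b = i then c * A $$ (a, b) * M (a, 0) $$ (k, j) else 0)"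
        using MM by (intro sum.cong refl) auto
      also have "\<dots> = (\<Sum>a<N. c * A $$ (a, i) * M (a, 0) $$ (k, j))"
        using ki by simp
      also have "\<dots> = (S * A) $$ (k, i)"
        using ki Sc A by (subst index_mult_mat_sum[where N = N]) (auto simp: S_index mult_ac)
      finally show "(?T * S) $$ (k, i) = (S * A) $$ (k, i)" .
    qed (use Sc A in \<open>auto simp: mat_lincomb_def\<close>)
    then have "S * A * mat_adjoint S = ?T * S * mat_adjoint S" by simp
    also have "\<dots> = ?T * (S * mat_adjoint S)"
      by (rule assoc_mult_mat[OF mat_lincomb_carrier Sc Sa])
    also have "\<dots> = ?T" using SS' right_mult_one_mat[OF mat_lincomb_carrier] by simp
    finally show ?thesis by simp
  qed
  moreover have "unitary_mat S" using SS SS' Sc by (simp add: unitary_mat_def)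
  ultimately show ?thesis using Sc by blast
qed

text \<open>A one-sided inverse of a square matrix is two-sided; the enumeration \<open>h\<close> of
  \<open>P\<close> turns arrays over \<open>P\<close> into matrices.\<close>

lemma finite_left_right_inverse:
  fixes U V :: "'p \<Rightarrow> 'p \<Rightarrow> complex"
  assumes fin: "finite P"
    and UV: "\<And>p q. p \<in> P \<Longrightarrow> q \<in> P \<Longrightarrow> (\<Sum>s\<in>P. U p s * V s q) = (if p = q then 1 else 0)"
    and pq: "p \<in> P" "q \<in> P"
  shows "(\<Sum>s\<in>P. V p s * U s q) = (if p = q then 1 else 0)"
proof -
  obtain h where h: "bij_betw h {..<card P} P"
    using fin ex_bij_betw_nat_finite lessThan_atLeast0 by metis
  let ?n = "card P"
  let ?M = "\<lambda>f. mat ?n ?n (\<lambda>(i, j). f (h i) (h j))"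
  have hP: "h i \<in> P" if "i < ?n" for i using h that by (auto simp: bij_betw_def)
  have hinj: "h i = h j \<longleftrightarrow> i = j" if "i < ?n" "j < ?n" for i j
    using h that by (auto simp: bij_betw_def inj_on_def)
  have mult: "(?M f * ?M g) $$ (i, j) = (\<Sum>s\<in>P. f (h i) s * g s (h j))"
    if "i < ?n" "j < ?n" for f g :: "'p \<Rightarrow> 'p \<Rightarrow> complex" and i j
    using that sum.reindex_bij_betw[OF h, of "\<lambda>s. f (h i) s * g s (h j)"]
    by (subst index_mult_mat_sum[where N = ?n]) auto
  have "?M U * ?M V = 1\<^sub>m ?n"
    by (rule eq_matI) (use mult UV hP hinj in auto)
  then have VU: "?M V * ?M U = 1\<^sub>m ?n"
    by (rule mat_mult_left_right_inverse[rotated 2]) auto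
  obtain i j where ij: "i < ?n" "j < ?n" "p = h i" "q = h j"
    using pq h unfolding bij_betw_def by (metis imageE lessThan_iff)
  have "(\<Sum>s\<in>P. V p s * U s q) = (?M V * ?M U) $$ (i, j)"
    using mult ij by simp
  then show ?thesis using VU ij hinj by simp
qed

text \<open>There are N^2 matrices \<open>M p\<close> in a space of dimension N^2, so orthonormality
  implies completeness, and the entries of \<open>X\<close> are recovered from the traces
  \<open>mat_trace (M p * X)\<close>.\<close>

lemma orthonormal_trace_zero:
  fixes M :: "nat \<times> nat \<Rightarrow> complex mat"
  assumes car: "\<And>p. p \<in> mat_indices N \<Longrightarrow> M p \<in> carrier_mat N N"
    and orth: "\<And>p q. p \<in> mat_indices N \<Longrightarrow> q \<in> mat_indices N \<Longrightarrow>
      mat_trace (M p * mat_adjoint (M q)) = (if p = q then 1 else 0)"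
    and X: "X \<in> carrier_mat N N"
    and zero: "\<And>p. p \<in> mat_indices N \<Longrightarrow> mat_trace (M p * X) = 0"
  shows "X = 0\<^sub>m N N"
proof (rule eq_matI)
  let ?P = "mat_indices N"
  have tr: "mat_trace (M p * Y) = (\<Sum>s\<in>?P. M p $$ s * Y $$ (snd s, fst s))"
    if "p \<in> ?P" "Y \<in> carrier_mat N N" for p Y
    using mat_trace_mult[OF car[OF that(1)] that(2)]
    by (simp add: sum.cartesian_product case_prod_beta)
  have UV: "(\<Sum>s\<in>?P. M p $$ s * cnj (M q $$ s)) = (if p = q then 1 else 0)"
    if "p \<in> ?P" "q \<in> ?P" for p q
  proof -
    have "(\<Sum>s\<in>?P. M p $$ s * cnj (M q $$ s)) =
        (\<Sum>s\<in>?P. M p $$ s * mat_adjoint (M q) $$ (snd s, fst s))"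
      using index_mat_adjoint[OF car[OF that(2)]] by (intro sum.cong refl) auto
    also have "\<dots> = mat_trace (M p * mat_adjoint (M q))"
      using tr[OF that(1)] car[OF that(2)] by simp
    finally show ?thesis using orth[OF that] by simp
  qed
  \<comment> \<open>The completeness relation: with matrices flattened to vectors over index pairs,
    orthonormal rows of a square array force orthonormal columns.\<close>
  have VU: "(\<Sum>s\<in>?P. cnj (M s $$ p) * M s $$ q) = (if p = q then 1 else 0)"
    if "p \<in> ?P" "q \<in> ?P" for p q
    using finite_left_right_inverse[of ?P "\<lambda>p s. M p $$ s" "\<lambda>s q. cnj (M q $$ s)"] UV that
    by simp
  fix a b assume "a < dim_row (0\<^sub>m N N)" "b < dim_col (0\<^sub>m N N)"
  then have ab: "a < N" "b < N" by auto
  have "X $$ (a, b) = (\<Sum>s\<in>?P. if (b, a) = s then X $$ (snd s, fst s) else 0)"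
    using ab by (subst sum.delta') auto
  also have "\<dots> = (\<Sum>s\<in>?P. (\<Sum>t\<in>?P. cnj (M t $$ (b, a)) * M t $$ s) * X $$ (snd s, fst s))"
    using VU[of "(b, a)"] ab by (intro sum.cong refl) auto
  also have "\<dots> = (\<Sum>s\<in>?P. \<Sum>t\<in>?P. cnj (M t $$ (b, a)) * (M t $$ s * X $$ (snd s, fst s)))"
    by (simp add: sum_distrib_right mult.assoc)
  also have "\<dots> = (\<Sum>t\<in>?P. cnj (M t $$ (b, a)) * mat_trace (M t * X))"
    by (subst sum.swap) (simp add: tr X sum_distrib_left)
  also have "\<dots> = 0" using zero by simp
  finally show "X $$ (a, b) = 0\<^sub>m N N $$ (a, b)" using ab by simp
qed (use X in auto)

section \<open>Representations with equal characters\<close>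

text \<open>Choosing one preimage for each matrix turns a combination over the image set into one
  over group elements; injectivity on the chosen set keeps the sum unchanged.\<close>

lemma spans_mat_lincomb:
  assumes sp: "spans_mat N (\<rho> ` B)" and A: "A \<in> carrier_mat N N"
  obtains S c where "finite S" "S \<subseteq> B" "A = mat_lincomb N \<rho> S c"
proof -
  have "\<forall>A\<in>carrier_mat N N. \<exists>S c. finite S \<and> S \<subseteq> \<rho> ` B \<and>
      (\<forall>i<N. \<forall>j<N. A $$ (i, j) = (\<Sum>M\<in>S. c M * M $$ (i, j)))"
    using sp unfolding spans_mat_def by (elim conjE)
  from bspec[OF this A] obtain X c where X: "finite X" "X \<subseteq> \<rho> ` B"
    and e: "\<And>i j. i < N \<Longrightarrow> j < N \<Longrightarrow> A $$ (i, j) = (\<Sum>M\<in>X. c M * M $$ (i, j))"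
    by (elim exE conjE) simp
  have "\<exists>S\<subseteq>B. inj_on \<rho> S \<and> X = \<rho> ` S"
    using X(2) by (simp only: subset_image_inj)
  then obtain S where S: "S \<subseteq> B" "inj_on \<rho> S" "\<rho> ` S = X"
    by auto
  have "finite S" using X(1) S(2,3) finite_imageD by metis
  moreover have "A = mat_lincomb N \<rho> S (\<lambda>g. c (\<rho> g))"
    by (rule eq_matI) (use A in \<open>auto simp: index_mat_lincomb e sum.reindex S(2) simp flip: S(3)\<close>)
  ultimately show ?thesis using that S(1) by metis
qed

section \<open>The general linear group and trace identities\<close>

lemma GL_mat_iff:
  "A \<in> carrier (GL_mat N) \<longleftrightarrow>
    A \<in> carrier_mat N N \<and> (\<exists>B\<in>carrier_mat N N. A * B = 1\<^sub>m N \<and> B * A = 1\<^sub>m N)"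
proof
  assume "A \<in> carrier (GL_mat N)"
  then have Ac: "A \<in> carrier_mat N N" and "invertible_mat A" by (simp_all add: GL_mat_def)
  then have "\<exists>B. A * B = 1\<^sub>m N \<and> B * A = 1\<^sub>m (dim_row B)"
    by (simp add: invertible_mat_def inverts_mat_def)
  then obtain B where B: "A * B = 1\<^sub>m N" "B * A = 1\<^sub>m (dim_row B)" by (elim exE conjE)
  \<comment> \<open>\<open>invertible_mat\<close> leaves the size of the inverse open; comparing
    dimensions in the two identities fixes it.\<close>
  have "dim_col B = N" "dim_row B = N"
    using Ac arg_cong[OF B(1), of dim_col] arg_cong[OF B(2), of dim_col] by simp_all
  then have "B \<in> carrier_mat N N" "B * A = 1\<^sub>m N" using B by (auto intro: carrier_matI)
  with Ac B(1) show "A \<in> carrier_mat N N \<and> (\<exists>B\<in>carrier_mat N N. A * B = 1\<^sub>m N \<and> B * A = 1\<^sub>m N)"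
    by metis
next
  assume "A \<in> carrier_mat N N \<and> (\<exists>B\<in>carrier_mat N N. A * B = 1\<^sub>m N \<and> B * A = 1\<^sub>m N)"
  then obtain B where "A \<in> carrier_mat N N" "B \<in> carrier_mat N N" "A * B = 1\<^sub>m N" "B * A = 1\<^sub>m N"
    by (elim conjE bexE)
  then have "A \<in> carrier_mat N N" "square_mat A" "inverts_mat A B" "inverts_mat B A"
    by (simp_all add: inverts_mat_def)
  then show "A \<in> carrier (GL_mat N)" unfolding GL_mat_def invertible_mat_def by auto
qed

lemma GL_mat_simps:
  "x \<otimes>\<^bsub>GL_mat N\<^esub> y = x * y" "\<one>\<^bsub>GL_mat N\<^esub> = 1\<^sub>m N"
  by (simp_all add: GL_mat_def)

lemma group_GL_mat: "group (GL_mat N)"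
proof (rule groupI)
  fix x y assume "x \<in> carrier (GL_mat N)" "y \<in> carrier (GL_mat N)"
  then obtain x' y' where c: "x \<in> carrier_mat N N" "y \<in> carrier_mat N N"
      "x' \<in> carrier_mat N N" "y' \<in> carrier_mat N N"
    and i: "x * x' = 1\<^sub>m N" "x' * x = 1\<^sub>m N" "y * y' = 1\<^sub>m N" "y' * y = 1\<^sub>m N"
    unfolding GL_mat_iff by (elim conjE bexE)
  have "(x * y) * (y' * x') = x * ((y * y') * x')"
    using assoc_mult_mat[OF c(1,2) mult_carrier_mat[OF c(4,3)]] assoc_mult_mat[OF c(2,4,3)]
    by presburger
  then have 1: "(x * y) * (y' * x') = 1\<^sub>m N"
    using c i by simp
  have "(y' * x') * (x * y) = y' * ((x' * x) * y)"
    using assoc_mult_mat[OF c(4,3) mult_carrier_mat[OF c(1,2)]] assoc_mult_mat[OF c(3,1,2)]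
    by presburger
  then have 2: "(y' * x') * (x * y) = 1\<^sub>m N"
    using c i by simp
  show "x \<otimes>\<^bsub>GL_mat N\<^esub> y \<in> carrier (GL_mat N)"
    unfolding GL_mat_iff GL_mat_simps
    using 1 2 mult_carrier_mat[OF c(1,2)] mult_carrier_mat[OF c(4,3)] by metis
next
  fix x assume "x \<in> carrier (GL_mat N)"
  then obtain y where "x \<in> carrier_mat N N" "y \<in> carrier_mat N N" "x * y = 1\<^sub>m N" "y * x = 1\<^sub>m N"
    unfolding GL_mat_iff by (elim conjE bexE)
  then have "y \<in> carrier (GL_mat N)" "y * x = 1\<^sub>m N" unfolding GL_mat_iff by metis+
  then show "\<exists>y\<in>carrier (GL_mat N). y \<otimes>\<^bsub>GL_mat N\<^esub> x = \<one>\<^bsub>GL_mat N\<^esub>"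
    unfolding GL_mat_simps by metis
next
  show "\<one>\<^bsub>GL_mat N\<^esub> \<in> carrier (GL_mat N)"
    unfolding GL_mat_iff GL_mat_simps by (intro conjI bexI[of _ "1\<^sub>m N"]) simp_all
next
  fix x y z assume "x \<in> carrier (GL_mat N)" "y \<in> carrier (GL_mat N)" "z \<in> carrier (GL_mat N)"
  then show "x \<otimes>\<^bsub>GL_mat N\<^esub> y \<otimes>\<^bsub>GL_mat N\<^esub> z = x \<otimes>\<^bsub>GL_mat N\<^esub> (y \<otimes>\<^bsub>GL_mat N\<^esub> z)"
    unfolding GL_mat_iff GL_mat_simps by (elim conjE) (rule assoc_mult_mat)
next
  fix x assume "x \<in> carrier (GL_mat N)"
  then show "\<one>\<^bsub>GL_mat N\<^esub> \<otimes>\<^bsub>GL_mat N\<^esub> x = x"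
    unfolding GL_mat_iff GL_mat_simps by (elim conjE) (rule left_mult_one_mat)
qed

lemma mat_trace_mult_commute:
  assumes "X \<in> carrier_mat N N" "Y \<in> carrier_mat N N"
  shows "mat_trace (X * Y) = mat_trace (Y * X)"
  unfolding mat_trace_mult[OF assms] mat_trace_mult[OF assms(2,1)]
  by (subst sum.swap) (simp add: mult.commute)

lemma mat_trace_mult_diff:
  assumes A: "A \<in> carrier_mat N N" and B: "B \<in> carrier_mat N N" and C: "C \<in> carrier_mat N N"
  shows "mat_trace (A * (B - C)) = mat_trace (A * B) - mat_trace (A * C)"
proof -
  have BC: "B - C \<in> carrier_mat N N" by (rule minus_carrier_mat[OF C])
  show ?thesis
    unfolding mat_trace_mult[OF A B] mat_trace_mult[OF A C] mat_trace_mult[OF A BC]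
    using B C by (simp add: right_diff_distrib sum_subtractf)
qed

lemma mat_trace_elem_mat:
  assumes "i < N"
  shows "mat_trace (elem_mat N (i, j)) = (if i = j then 1 else 0)"
proof -
  have "mat_trace (elem_mat N (i, j)) = (\<Sum>k<N. if k = i then (if i = j then 1 else 0) else 0)"
    unfolding mat_trace_def elem_mat_def by (intro sum.cong) auto
  then show ?thesis using assms by simp
qed

lemma mat_trace_mult_lincomb:
  assumes Y: "Y \<in> carrier_mat N N" and f: "\<And>g. g \<in> X \<Longrightarrow> f g \<in> carrier_mat N N"
  shows "mat_trace (Y * mat_lincomb N f X a) = (\<Sum>g\<in>X. a g * mat_trace (Y * f g))"
proof -
  have "mat_trace (Y * mat_lincomb N f X a) = (\<Sum>g\<in>X. a g * mat_trace (f g * Y))"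
    unfolding mat_trace_mult_commute[OF Y mat_lincomb_carrier]
    by (rule mat_trace_lincomb_mult[OF f Y])
  also have "\<dots> = (\<Sum>g\<in>X. a g * mat_trace (Y * f g))"
    by (rule sum.cong[OF refl]) (simp add: mat_trace_mult_commute[OF f Y])
  finally show ?thesis .
qed

text \<open>Linearity of the map that replaces each elementary matrix by \<open>M p\<close>, in the
  form that moves it through combinations indexed by \<open>X\<close>.\<close>

lemma mat_lincomb_indices:
  "mat_lincomb N M (mat_indices N) (\<lambda>p. mat_lincomb N f X a $$ p) =
    mat_lincomb N (\<lambda>g. mat_lincomb N M (mat_indices N) (\<lambda>p. f g $$ p)) X a"
    (is "?L = ?R")
proof (rule eq_matI)
  fix i j assume "i < dim_row ?R" "j < dim_col ?R"
  then have ij: "i < N" "j < N" by auto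
  have "?L $$ (i, j) = (\<Sum>p\<in>mat_indices N. \<Sum>g\<in>X. a g * (f g $$ p * M p $$ (i, j)))"
    using ij by (auto simp: index_mat_lincomb sum_distrib_right mult.assoc intro!: sum.cong)
  also have "\<dots> = ?R $$ (i, j)"
    using ij by (subst sum.swap) (simp add: index_mat_lincomb sum_distrib_left)
  finally show "?L $$ (i, j) = ?R $$ (i, j)" .
qed auto

text \<open>\<open>st\<close> handles both kinds of spanning set at once: the identity for Hermitian
  values, the group inverse for unitary ones. What matters is that one group element yields the
  adjoint in both representations.\<close>

lemma unitary_equivalence_of_characters:
  fixes G :: "('g, 'b) monoid_scheme" (structure)
  assumes "group G" and N: "N > 0"
    and \<rho>1: "\<rho>1 \<in> hom G (GL_mat N)" and \<rho>2: "\<rho>2 \<in> hom G (GL_mat N)"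
    and chi: "\<And>g. g \<in> carrier G \<Longrightarrow> mat_trace (\<rho>1 g) = mat_trace (\<rho>2 g)"
    and B: "B \<subseteq> carrier G" and sp: "spans_mat N (\<rho>1 ` B)"
    and st: "\<And>g. g \<in> B \<Longrightarrow> st g \<in> carrier G"
    and st1: "\<And>g. g \<in> B \<Longrightarrow> mat_adjoint (\<rho>1 g) = \<rho>1 (st g)"
    and st2: "\<And>g. g \<in> B \<Longrightarrow> mat_adjoint (\<rho>2 g) = \<rho>2 (st g)"
  shows "\<exists>S \<in> carrier_mat N N. unitary_mat S \<and>
    (\<forall>g\<in>carrier G. \<rho>2 g = S * \<rho>1 g * mat_adjoint S)"
proof -
  interpret group G by fact
  let ?P = "mat_indices N"
  have car: "\<rho>1 g \<in> carrier_mat N N" "\<rho>2 g \<in> carrier_mat N N" if "g \<in> carrier G" for g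
    using that \<rho>1 \<rho>2 by (auto simp: hom_def GL_mat_def)
  have mult: "\<rho>1 (g \<otimes> h) = \<rho>1 g * \<rho>1 h" "\<rho>2 (g \<otimes> h) = \<rho>2 g * \<rho>2 h"
    if "g \<in> carrier G" "h \<in> carrier G" for g h
    using that \<rho>1 \<rho>2 by (auto simp: hom_def GL_mat_def)
  have one: "\<rho>1 \<one> = 1\<^sub>m N" "\<rho>2 \<one> = 1\<^sub>m N"
    using hom_one[OF \<rho>1 is_group group_GL_mat] hom_one[OF \<rho>2 is_group group_GL_mat]
    by (auto simp: GL_mat_def)
  \<comment> \<open>Expansions are chosen for every pair \<open>p\<close>; outside the index range
    \<open>elem_mat N p\<close> is the zero matrix, so no side condition arises.\<close>
  have "\<exists>Sc. fst Sc \<subseteq> B \<and> elem_mat N p = mat_lincomb N \<rho>1 (fst Sc) (snd Sc)" for p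
    by (rule spans_mat_lincomb[OF sp elem_mat_carrier[of N p]]) auto
  then have "\<exists>Sc. \<forall>p. fst (Sc p) \<subseteq> B \<and>
      elem_mat N p = mat_lincomb N \<rho>1 (fst (Sc p)) (snd (Sc p))"
    by (intro choice allI)
  then obtain Sc where Sc: "\<forall>p. fst (Sc p) \<subseteq> B \<and>
      elem_mat N p = mat_lincomb N \<rho>1 (fst (Sc p)) (snd (Sc p))" ..
  define S c where "S p = fst (Sc p)" and "c p = snd (Sc p)" for p
  have S: "S p \<subseteq> B" and E: "elem_mat N p = mat_lincomb N \<rho>1 (S p) (c p)" for p
    using Sc[rule_format, of p] unfolding S_def c_def by blast+
  have SG: "g \<in> carrier G" if "g \<in> S p" for g p using that S B by blast
  define M where "M p = mat_lincomb N \<rho>2 (S p) (c p)" for p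
  have Mc [simp]: "M p \<in> carrier_mat N N" for p by (simp add: M_def)
  define T where "T A = mat_lincomb N M ?P (\<lambda>p. A $$ p)" for A :: "complex mat"
  \<comment> \<open>Both traces expand into characters at products of group elements, where the two
    representations agree.\<close>
  have tr_M: "mat_trace (M p * \<rho>2 h) = mat_trace (elem_mat N p * \<rho>1 h)" if h: "h \<in> carrier G" for p h
  proof -
    have "mat_trace (M p * \<rho>2 h) = (\<Sum>g\<in>S p. c p g * mat_trace (\<rho>2 g * \<rho>2 h))"
      unfolding M_def by (rule mat_trace_lincomb_mult) (use SG car h in auto)
    also have "\<dots> = (\<Sum>g\<in>S p. c p g * mat_trace (\<rho>1 g * \<rho>1 h))"
      using SG h by (intro sum.cong refl) (simp flip: mult add: chi)
    also have "\<dots> = mat_trace (elem_mat N p * \<rho>1 h)"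
      unfolding E by (rule mat_trace_lincomb_mult[symmetric]) (use SG car h in auto)
    finally show ?thesis .
  qed
  have M_adj: "mat_adjoint (M p) = mat_lincomb N (\<lambda>g. \<rho>2 (st g)) (S p) (\<lambda>g. cnj (c p g))" for p
    unfolding M_def using SG car S st2
    by (subst mat_adjoint_lincomb) (blast intro!: mat_lincomb_cong)+
  have E_adj: "mat_adjoint (elem_mat N p) = mat_lincomb N (\<lambda>g. \<rho>1 (st g)) (S p) (\<lambda>g. cnj (c p g))" for p
    unfolding E using SG car S st1
    by (subst mat_adjoint_lincomb) (blast intro!: mat_lincomb_cong)+
  have stc: "st g \<in> carrier G" if "g \<in> S p" for g p using st S that by blast
  \<comment> \<open>The adjoint of \<open>M q\<close> is again a combination of values of
    \<open>\<rho>2\<close>, so the trace reduces to the corresponding one for elementary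
    matrices.\<close>
  have orth: "mat_trace (M p * mat_adjoint (M q)) = (if p = q then 1 else 0)"
    if pq: "p \<in> ?P" "q \<in> ?P" for p q
  proof -
    have "mat_trace (M p * mat_adjoint (M q)) =
        (\<Sum>g\<in>S q. cnj (c q g) * mat_trace (M p * \<rho>2 (st g)))"
      unfolding M_adj by (rule mat_trace_mult_lincomb) (use stc car in auto)
    also have "\<dots> = (\<Sum>g\<in>S q. cnj (c q g) * mat_trace (elem_mat N p * \<rho>1 (st g)))"
      using stc by (intro sum.cong refl) (auto simp: tr_M)
    also have "\<dots> = mat_trace (elem_mat N p * mat_adjoint (elem_mat N q))"
      unfolding E_adj by (rule mat_trace_mult_lincomb[symmetric]) (use stc car in auto)
    also have "\<dots> = (if p = q then 1 else 0)"
    proof -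
      obtain a b a' b' where ab: "p = (a, b)" "q = (a', b')" by (metis surj_pair)
      then have "elem_mat N p * mat_adjoint (elem_mat N q) = (if b = b' then elem_mat N (a, a') else 0\<^sub>m N N)"
        using pq by (simp add: elem_mat_adjoint elem_mat_mult)
      then show ?thesis using pq ab by (auto simp: mat_trace_elem_mat mat_trace_def[of "0\<^sub>m N N"])
    qed
    finally show ?thesis .
  qed
  \<comment> \<open>The difference has trace zero against every \<open>\<rho>2 h\<close>, hence
    against every \<open>M p\<close>, and completeness makes it vanish.\<close>
  have T_rho: "T (\<rho>1 g) = \<rho>2 g" if g: "g \<in> carrier G" for g
  proof -
    have Tc: "T (\<rho>1 g) \<in> carrier_mat N N" by (simp add: T_def)
    have tr0: "mat_trace (T (\<rho>1 g) * \<rho>2 h) = mat_trace (\<rho>2 g * \<rho>2 h)" if h: "h \<in> carrier G" for h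
    proof -
      have "mat_trace (T (\<rho>1 g) * \<rho>2 h) = (\<Sum>p\<in>?P. \<rho>1 g $$ p * mat_trace (elem_mat N p * \<rho>1 h))"
        unfolding T_def using h car by (subst mat_trace_lincomb_mult) (auto simp: tr_M)
      also have "\<dots> = mat_trace (\<rho>1 g * \<rho>1 h)"
        using mat_trace_lincomb_mult[of ?P "elem_mat N" N "\<rho>1 h" "\<lambda>p. \<rho>1 g $$ p"] h car g
        by (simp add: mat_lincomb_elem_mat)
      finally show ?thesis using g h by (simp flip: mult add: chi)
    qed
    have "T (\<rho>1 g) - \<rho>2 g = 0\<^sub>m N N"
    proof (rule orthonormal_trace_zero[of N M])
      fix p assume "p \<in> ?P"
      have "mat_trace (M p * Y) = (\<Sum>h\<in>S p. c p h * mat_trace (\<rho>2 h * Y))"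
        if "Y \<in> carrier_mat N N" for Y
        unfolding M_def by (rule mat_trace_lincomb_mult) (use SG car that in auto)
      moreover have "mat_trace (\<rho>2 h * (T (\<rho>1 g) - \<rho>2 g)) = 0" if h: "h \<in> S p" for h
      proof -
        have "mat_trace (\<rho>2 h * (T (\<rho>1 g) - \<rho>2 g)) =
            mat_trace (\<rho>2 h * T (\<rho>1 g)) - mat_trace (\<rho>2 h * \<rho>2 g)"
          using car[OF SG[OF h]] car[OF g] Tc
          by (intro mat_trace_mult_diff)
        also have "\<dots> = mat_trace (T (\<rho>1 g) * \<rho>2 h) - mat_trace (\<rho>2 g * \<rho>2 h)"
          using car[OF SG[OF h]] car[OF g] Tc by (metis mat_trace_mult_commute)
        finally have "mat_trace (\<rho>2 h * (T (\<rho>1 g) - \<rho>2 g)) =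
            mat_trace (T (\<rho>1 g) * \<rho>2 h) - mat_trace (\<rho>2 g * \<rho>2 h)" .
        then show ?thesis using tr0[OF SG[OF h]] by simp
      qed
      ultimately show "mat_trace (M p * (T (\<rho>1 g) - \<rho>2 g)) = 0"
        using minus_carrier_mat[OF car(2)[OF g]] by simp
    qed (use orth minus_carrier_mat[OF car(2)[OF g]] in simp_all)
    then have "(T (\<rho>1 g) - \<rho>2 g) $$ (i, j) = 0" if "i < N" "j < N" for i j
      using that by simp
    then show ?thesis using Tc car[OF g] by (intro eq_matI) auto
  qed
  have T_lincomb: "T (mat_lincomb N f X a) = mat_lincomb N (\<lambda>g. T (f g)) X a"
    for f :: "'g \<Rightarrow> complex mat" and X a
    unfolding T_def by (rule mat_lincomb_indices)
  have T_E: "T (elem_mat N p) = M p" for p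
    unfolding E M_def T_lincomb by (rule mat_lincomb_cong) (use SG[of _ p] T_rho in auto)
  have T_0: "T (0\<^sub>m N N) = 0\<^sub>m N N"
    by (rule eq_matI) (auto simp: T_def index_mat_lincomb intro!: sum.neutral)
  \<comment> \<open>\<open>T\<close> is multiplicative on elementary matrices because it carries
    values of \<open>\<rho>1\<close> to values of \<open>\<rho>2\<close> and both are
    homomorphisms.\<close>
  have "M p * M q = T (elem_mat N p * elem_mat N q)" for p q
  proof -
    have "M p * M q = mat_lincomb N (\<lambda>(g, h). \<rho>2 g * \<rho>2 h) (S p \<times> S q) (\<lambda>(g, h). c p g * c q h)"
      unfolding M_def by (rule mat_lincomb_mult) (use SG[of _ p] SG[of _ q] car in auto)
    also have "\<dots> = mat_lincomb N (\<lambda>x. T (case x of (g, h) \<Rightarrow> \<rho>1 g * \<rho>1 h)) (S p \<times> S q)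
        (\<lambda>(g, h). c p g * c q h)"
      by (rule mat_lincomb_cong) (use SG[of _ p] SG[of _ q] T_rho in \<open>auto simp flip: mult\<close>)
    also have "\<dots> = T (mat_lincomb N (\<lambda>(g, h). \<rho>1 g * \<rho>1 h) (S p \<times> S q) (\<lambda>(g, h). c p g * c q h))"
      unfolding T_def by (rule mat_lincomb_indices[symmetric])
    also have "mat_lincomb N (\<lambda>(g, h). \<rho>1 g * \<rho>1 h) (S p \<times> S q) (\<lambda>(g, h). c p g * c q h) =
        elem_mat N p * elem_mat N q"
      unfolding E by (rule mat_lincomb_mult[symmetric]) (use SG[of _ p] SG[of _ q] car in auto)
    finally show ?thesis .
  qed
  then have M_mult: "M (i, j) * M (k, l) = (if j = k then M (i, l) else 0\<^sub>m N N)"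
    if "i < N" "j < N" "k < N" "l < N" for i j k l
    using that by (simp add: elem_mat_mult T_E T_0)
  have "mat_adjoint (M p) = T (mat_adjoint (elem_mat N p))" for p
    unfolding M_adj E_adj T_lincomb
    by (rule mat_lincomb_cong) (use stc[of _ p] T_rho in auto)
  then have M_adjoint: "mat_adjoint (M (i, j)) = M (j, i)" for i j
    by (simp add: elem_mat_adjoint T_E)
  have "mat_trace (M (0, 0)) = mat_trace (elem_mat N (0, 0))"
    using tr_M[OF one_closed, of "(0, 0)"]
    by (simp add: one right_mult_one_mat[OF Mc] right_mult_one_mat[OF elem_mat_carrier])
  also have "\<dots> = 1" using N by (simp add: mat_trace_elem_mat)
  finally have "mat_trace (M (0, 0)) \<noteq> 0" by simp
  then have "\<exists>U \<in> carrier_mat N N. unitary_mat U \<and>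
      (\<forall>A \<in> carrier_mat N N. T A = U * A * mat_adjoint U)"
    unfolding T_def by (intro matrix_units_unitary N Mc M_mult M_adjoint)
  then show ?thesis using T_rho car(1) by metis
qed

section \<open>Symplectic bases modulo a prime\<close>

lemma zd_vecs_cong_eq:
  assumes "x \<in> zd_vecs d n" "y \<in> zd_vecs d n" "\<And>j. j < n \<Longrightarrow> [x j = y j] (mod d)"
  shows "x = y"
proof
  fix j show "x j = y j"
  proof (cases "j < n")
    case True
    then have "x j mod d = x j" "y j mod d = y j" "x j mod d = y j mod d"
      using assms by (auto simp: zd_vecs_def cong_def)
    then show ?thesis by linarith
  qed (use assms in \<open>auto simp: zd_vecs_def\<close>)
qed

text \<open>Entries from \<open>n\<close> on are \<open>0\<close> in \<open>zd_vecs\<close> but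
  \<open>undefined\<close> in the extensional function space; restriction moves between the
  conventions so that vectors can be counted.\<close>

lemma bij_betw_zd_vecs: "bij_betw (\<lambda>x. restrict x {..<n}) (zd_vecs d n) ({..<n} \<rightarrow>\<^sub>E {0..<d})"
proof (rule bij_betw_imageI)
  show "inj_on (\<lambda>x. restrict x {..<n}) (zd_vecs d n)"
  proof (rule inj_onI)
    fix x y assume xy: "x \<in> zd_vecs d n" "y \<in> zd_vecs d n"
      and eq: "restrict x {..<n} = restrict y {..<n}"
    have "x j = y j" if "j < n" for j using fun_cong[OF eq, of j] that by simp
    then show "x = y" by (intro zd_vecs_cong_eq[OF xy]) simp
  qed
  show "(\<lambda>x. restrict x {..<n}) ` zd_vecs d n = {..<n} \<rightarrow>\<^sub>E {0..<d}"
  proof (intro equalityI subsetI)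
    fix f assume "f \<in> (\<lambda>x. restrict x {..<n}) ` zd_vecs d n"
    then obtain x where "x \<in> zd_vecs d n" "f = restrict x {..<n}" by (elim imageE) simp
    then show "f \<in> {..<n} \<rightarrow>\<^sub>E {0..<d}" by (simp add: zd_vecs_def restrict_PiE_iff)
  next
    fix f assume f: "f \<in> {..<n} \<rightarrow>\<^sub>E {0..<d}"
    let ?x = "\<lambda>j. if j < n then f j else 0"
    have "?x \<in> zd_vecs d n" using PiE_mem[OF f] by (simp add: zd_vecs_def)
    moreover have "f = restrict ?x {..<n}"
      using PiE_arb[OF f] by (intro ext) (simp add: restrict_def)
    ultimately show "f \<in> (\<lambda>x. restrict x {..<n}) ` zd_vecs d n" by (intro image_eqI)
  qed
qed

lemma finite_zd_vecs: "finite (zd_vecs d n)"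
  using bij_betw_finite[OF bij_betw_zd_vecs[of n d]] by (simp add: finite_PiE)

lemma card_zd_vecs: "card (zd_vecs (int d) n) = d ^ n"
  using bij_betw_same_card[OF bij_betw_zd_vecs[of n "int d"]] by (simp add: card_PiE)

text \<open>The form is left unreduced, so bilinearity is an identity of integers; reduction happens
  only in congruences and exponents.\<close>

definition bform :: "nat \<Rightarrow> (nat \<Rightarrow> nat \<Rightarrow> int) \<Rightarrow> (nat \<Rightarrow> int) \<Rightarrow> (nat \<Rightarrow> int) \<Rightarrow> int" where
  "bform n W x y = (\<Sum>i<n. \<Sum>j<n. x i * W i j * y j)"

lemma bilin_eq_bform: "bilin d n W x y = bform n W x y mod d"
  by (simp add: bilin_def bform_def)

lemma bform_transpose: "bform n W y x = bform n (\<lambda>i j. W j i) x y"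
  unfolding bform_def by (subst sum.swap) (simp add: mult_ac)

lemma bform_sum_left:
  "bform n W (\<lambda>j. \<Sum>i\<in>I. a i * E i j) y = (\<Sum>i\<in>I. a i * bform n W (E i) y)"
proof -
  have "bform n W (\<lambda>j. \<Sum>i\<in>I. a i * E i j) y =
      (\<Sum>k<n. \<Sum>l<n. \<Sum>i\<in>I. a i * (E i k * W k l * y l))"
    unfolding bform_def by (simp add: sum_distrib_right mult.assoc)
  also have "\<dots> = (\<Sum>k<n. \<Sum>i\<in>I. \<Sum>l<n. a i * (E i k * W k l * y l))"
    by (intro sum.cong refl sum.swap)
  also have "\<dots> = (\<Sum>i\<in>I. \<Sum>k<n. \<Sum>l<n. a i * (E i k * W k l * y l))"
    by (rule sum.swap)
  finally show ?thesis by (simp add: bform_def sum_distrib_left)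
qed

lemma bform_sum_right:
  "bform n W x (\<lambda>j. \<Sum>i\<in>I. a i * E i j) = (\<Sum>i\<in>I. a i * bform n W x (E i))"
  unfolding bform_transpose[of n W x] by (rule bform_sum_left)

lemma bform_add_left: "bform n W (\<lambda>j. x j + x' j) y = bform n W x y + bform n W x' y"
  by (simp add: bform_def algebra_simps sum.distrib)

lemma bform_add_right: "bform n W x (\<lambda>j. y j + y' j) = bform n W x y + bform n W x y'"
  by (simp add: bform_def algebra_simps sum.distrib)

lemma bform_diff_right: "bform n W x (\<lambda>j. y j - y' j) = bform n W x y - bform n W x y'"
  by (simp add: bform_def algebra_simps sum_subtractf)

lemma bform_cong:
  assumes "\<And>i. i < n \<Longrightarrow> [x i = x' i] (mod d)" "\<And>i. i < n \<Longrightarrow> [y i = y' i] (mod d)"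
    "\<And>i j. i < n \<Longrightarrow> j < n \<Longrightarrow> [W i j = W' i j] (mod d)"
  shows "[bform n W x y = bform n W' x' y'] (mod d)"
  unfolding bform_def using assms by (intro cong_sum cong_mult) auto

lemma bform_mat_diff: "bform n (\<lambda>i j. W i j - W' i j) x y = bform n W x y - bform n W' x y"
  by (simp add: bform_def algebra_simps sum_subtractf)

text \<open>Half of the form with hyperbolic pairs \<open>(2k, 2k + 1)\<close>: the normal form for
  \<open>W\<close>, whose antisymmetrisation is the standard symplectic matrix.\<close>

definition symp_half :: "nat \<Rightarrow> nat \<Rightarrow> int" where
  "symp_half i j = (if even i \<and> j = Suc i then 1 else 0)"

definition symp_std :: "nat \<Rightarrow> nat \<Rightarrow> int" where
  "symp_std i j = symp_half i j - symp_half j i"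

text \<open>Every index has exactly one partner, and evenness of \<open>m\<close> keeps that partner
  below \<open>m\<close>.\<close>

lemma symp_std_sum:
  assumes "even m" "j < m"
  shows "(\<Sum>i<m. symp_std j i * a i) = (if even j then a (Suc j) else - a (j - 1))"
proof (cases "even j")
  case True
  with assms have "Suc j < m" by (metis Suc_lessI even_Suc)
  moreover have "(\<Sum>i<m. symp_std j i * a i) = (\<Sum>i<m. if i = Suc j then a i else 0)"
    using True by (intro sum.cong) (auto simp: symp_std_def symp_half_def)
  ultimately show ?thesis using True by simp
next
  case False
  then have "j - 1 < m" "Suc (j - 1) = j" using assms by (auto elim: oddE)
  moreover have "(\<Sum>i<m. symp_std j i * a i) = (\<Sum>i<m. if i = j - 1 then - a i else 0)"
    using False by (intro sum.cong) (auto simp: symp_std_def symp_half_def elim: oddE)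
  ultimately show ?thesis using False by simp
qed

definition lin_map :: "int \<Rightarrow> nat \<Rightarrow> nat \<Rightarrow> (nat \<Rightarrow> nat \<Rightarrow> int) \<Rightarrow> (nat \<Rightarrow> int) \<Rightarrow> nat \<Rightarrow> int" where
  "lin_map d m n E x = (\<lambda>j. if j < n then (\<Sum>i<m. x i * E i j) mod d else 0)"

lemma lin_map_zd_vecs: "d > 0 \<Longrightarrow> lin_map d m n E x \<in> zd_vecs d n"
  by (auto simp: lin_map_def zd_vecs_def)

text \<open>Pairing a relation between the \<open>E i\<close> with \<open>E k\<close> isolates, up
  to sign, the coefficient at the partner of \<open>k\<close>. Every index is such a partner, so all
  coefficients vanish modulo \<open>d\<close>.\<close>

lemma lin_map_inj:
  assumes m: "even m"
    and gram: "\<And>i j. i < m \<Longrightarrow> j < m \<Longrightarrow> [bform n A (E i) (E j) = symp_std i j] (mod d)"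
  shows "inj_on (lin_map d m n E) (zd_vecs d m)"
proof (rule inj_onI)
  fix x y assume x: "x \<in> zd_vecs d m" and y: "y \<in> zd_vecs d m"
    and eq: "lin_map d m n E x = lin_map d m n E y"
  define c where "c i = x i - y i" for i
  have "[(\<Sum>i<m. x i * E i j) = (\<Sum>i<m. y i * E i j)] (mod d)" if "j < n" for j
    using fun_cong[OF eq, of j] that by (simp add: lin_map_def cong_def)
  then have cE: "[(\<Sum>i<m. c i * E i j) = 0] (mod d)" if "j < n" for j
    using that by (simp add: c_def left_diff_distrib sum_subtractf cong_iff_dvd_diff)
  have J: "[(if even k then c (Suc k) else - c (k - 1)) = 0] (mod d)" if k: "k < m" for k
  proof -
    have "[(\<Sum>i<m. symp_std k i * c i) = (\<Sum>i<m. c i * bform n A (E k) (E i))] (mod d)"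
      using gram k by (subst mult.commute) (intro cong_sum cong_mult, auto intro: cong_sym)
    also have "(\<Sum>i<m. c i * bform n A (E k) (E i)) = bform n A (E k) (\<lambda>j. \<Sum>i<m. c i * E i j)"
      by (simp add: bform_sum_right)
    also have "[\<dots> = bform n A (E k) (\<lambda>j. 0)] (mod d)"
      using cE by (intro bform_cong) auto
    also have "bform n A (E k) (\<lambda>j. 0) = 0" by (simp add: bform_def)
    finally show ?thesis using symp_std_sum[OF m k, of c] by simp
  qed
  show "x = y"
  proof (rule zd_vecs_cong_eq[OF x y])
    fix i assume i: "i < m"
    have "[c i = 0] (mod d)"
    proof (cases "even i")
      case True
      then have "Suc i < m" using m i by (metis Suc_lessI even_Suc)
      then show ?thesis using J[of "Suc i"] True by (simp add: cong_0_iff)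
    next
      case False
      then have "i - 1 < m" "even (i - 1)" "Suc (i - 1) = i" using i by (auto elim: oddE)
      then show ?thesis using J[of "i - 1"] by simp
    qed
    then show "[x i = y i] (mod d)" by (simp add: c_def cong_iff_dvd_diff cong_0_iff)
  qed
qed

text \<open>Counting yields a nonzero \<open>v\<close> orthogonal to all \<open>E i\<close>,
  nondegeneracy a vector pairing to \<open>1\<close> with \<open>v\<close>, and a correction makes
  the latter orthogonal to the \<open>E i\<close> as well.\<close>

lemma symplectic_extend:
  fixes d :: nat
  assumes d: "prime d"
    and skew: "\<And>i j. A i j = - A j i"
    and nondeg: "\<forall>v. (\<forall>i<n. [(\<Sum>j<n. A i j * v j) = 0] (mod int d)) \<longrightarrow>
      (\<forall>j<n. [v j = 0] (mod int d))"
    and m: "even m" "m < n"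
    and gram: "\<And>i j. i < m \<Longrightarrow> j < m \<Longrightarrow> [bform n A (E i) (E j) = symp_std i j] (mod int d)"
  shows "\<exists>E'. \<forall>i<m + 2. \<forall>j<m + 2. [bform n A (E' i) (E' j) = symp_std i j] (mod int d)"
proof -
  have d1: "d > 1" using d prime_gt_1_nat by blast
  have anti: "bform n A y x = - bform n A x y" for x y
  proof -
    have "bform n A y x = bform n (\<lambda>i j. - A i j) x y"
      unfolding bform_transpose[of n A y x] using skew by metis
    then show ?thesis by (simp add: bform_def sum_negf)
  qed
  \<comment> \<open>The pairings with the \<open>E i\<close> map d^n vectors into a set of d^m, so
    two vectors collide; their difference is \<open>v\<close>.\<close>
  let ?f = "\<lambda>x i. if i < m then bform n A (E i) x mod int d else 0"
  have "?f ` zd_vecs (int d) n \<subseteq> zd_vecs (int d) m"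
    using d1 by (auto simp: zd_vecs_def)
  then have "card (?f ` zd_vecs (int d) n) \<le> d ^ m"
    using card_mono[OF finite_zd_vecs, of "?f ` zd_vecs (int d) n" "int d" m]
    unfolding card_zd_vecs by simp
  also have "\<dots> < card (zd_vecs (int d) n)"
    using m d1 by (simp add: card_zd_vecs)
  finally have "\<not> inj_on ?f (zd_vecs (int d) n)"
    using card_image[of ?f "zd_vecs (int d) n"] by linarith
  then obtain x y where xy: "x \<in> zd_vecs (int d) n" "y \<in> zd_vecs (int d) n" "x \<noteq> y" "?f x = ?f y"
    by (auto simp: inj_on_def)
  define v where "v j = x j - y j" for j
  have Ev: "[bform n A (E i) v = 0] (mod int d)" if "i < m" for i
  proof -
    have "[bform n A (E i) x = bform n A (E i) y] (mod int d)"
      using fun_cong[OF xy(4), of i] that by (simp add: cong_def)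
    then show ?thesis by (simp add: v_def[abs_def] bform_diff_right cong_iff_dvd_diff)
  qed
  have "\<not> (\<forall>j<n. [v j = 0] (mod int d))"
  proof
    assume "\<forall>j<n. [v j = 0] (mod int d)"
    then have "[x j = y j] (mod int d)" if "j < n" for j
      using that by (simp add: v_def cong_iff_dvd_diff)
    then show False using zd_vecs_cong_eq[OF xy(1,2)] xy(3) by blast
  qed
  then obtain i where i: "i < n" "\<not> [(\<Sum>j<n. A i j * v j) = 0] (mod int d)"
    using nondeg by blast
  define s where "s = (\<Sum>j<n. A i j * v j)"
  have "coprime s (int d)"
    using i(2) d prime_imp_coprime[of "int d" s]
    by (simp add: s_def cong_0_iff coprime_commute)
  then obtain t where t: "[s * t = 1] (mod int d)" using cong_solve_coprime_int[of s "int d"] by blast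
  \<comment> \<open>A multiple of the \<open>i\<close>-th unit vector. By skewness \<open>v\<close>
    pairs with that unit vector to \<open>- s\<close>, which explains the sign of
    \<open>t\<close>.\<close>
  define w1 where "w1 j = (if j = i then - t else 0)" for j
  have "bform n A v w1 = (\<Sum>k<n. \<Sum>l<n. if l = i then v k * A k i * (- t) else 0)"
    unfolding bform_def w1_def by (intro sum.cong refl) auto
  also have "\<dots> = (\<Sum>k<n. v k * A k i * (- t))" using i by simp
  also have "\<dots> = s * t"
    unfolding s_def sum_distrib_right using skew[of _ i] by (intro sum.cong refl) simp
  finally have vw1: "[bform n A v w1 = 1] (mod int d)" using t by simp
  define b where "b j = bform n A (E j) w1" for j
  \<comment> \<open>The solution of \<open>(\<Sum>i<m. symp_std j i * a i) = b j\<close>, read off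
    from \<open>symp_std_sum\<close>; subtracting this combination projects \<open>w1\<close> onto
    the orthogonal complement of the \<open>E i\<close>.\<close>
  define a where "a j = (if odd j then b (j - 1) else - b (Suc j))" for j
  define w where "w j = w1 j - (\<Sum>i<m. a i * E i j)" for j
  have bw: "bform n A z w = bform n A z w1 - (\<Sum>i<m. a i * bform n A z (E i))" for z
    unfolding w_def[abs_def] bform_diff_right bform_sum_right ..
  have Ew: "[bform n A (E j) w = 0] (mod int d)" if j: "j < m" for j
  proof -
    have "[(\<Sum>i<m. a i * bform n A (E j) (E i)) = (\<Sum>i<m. a i * symp_std j i)] (mod int d)"
      using gram j by (intro cong_sum cong_mult) auto
    also have "(\<Sum>i<m. a i * symp_std j i) = b j"
      using symp_std_sum[OF m(1) j, of a] j by (simp add: mult.commute a_def)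
    finally show ?thesis unfolding bw b_def by (simp add: cong_iff_dvd_diff dvd_diff_commute)
  qed
  have vE: "[bform n A v (E j) = 0] (mod int d)" if "j < m" for j
    using Ev[OF that] anti[of v "E j"] by (simp add: cong_0_iff)
  \<comment> \<open>The correction does not disturb the pairing with \<open>v\<close>, which is
    orthogonal to every \<open>E i\<close>.\<close>
  have "[(\<Sum>i<m. a i * bform n A v (E i)) = (\<Sum>i<m. a i * 0)] (mod int d)"
    using vE by (intro cong_sum cong_mult) auto
  from cong_diff[OF vw1 this] have vw: "[bform n A v w = 1] (mod int d)"
    unfolding bw by simp
  \<comment> \<open>Skewness holds over the integers, not merely modulo \<open>d\<close>, so the
    form is alternating for \<open>d = 2\<close> too.\<close>
  have zero: "bform n A z z = 0" for z using anti[of z z] by simp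
  have neg: "[bform n A w (E j) = 0] (mod int d)" if "j < m" for j
    using Ew[OF that] anti[of w "E j"] by (simp add: cong_0_iff)
  have wv: "[bform n A w v = - 1] (mod int d)"
    using vw anti[of w v] cong_minus_minus_iff[of "bform n A v w" 1] by simp
  define E' where "E' = E(m := v, Suc m := w)"
  have E': "E' m = v" "E' (Suc m) = w" "\<And>i. i < m \<Longrightarrow> E' i = E i"
    by (auto simp: E'_def)
  have S: "symp_std i m = 0" "symp_std m i = 0" "symp_std i (Suc m) = 0" "symp_std (Suc m) i = 0" if "i < m" for i
    using that m by (auto simp: symp_std_def symp_half_def)
  have S': "symp_std m m = 0" "symp_std (Suc m) (Suc m) = 0" "symp_std m (Suc m) = 1" "symp_std (Suc m) m = -1"
    using m by (auto simp: symp_std_def symp_half_def)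
  have "[bform n A (E' i) (E' j) = symp_std i j] (mod int d)" if "i < m + 2" "j < m + 2" for i j
  proof -
    have "i < m \<or> i = m \<or> i = Suc m" "j < m \<or> j = m \<or> j = Suc m" using that by auto
    then show ?thesis
      by (elim disjE) (simp_all add: E' S S' zero gram Ev vE Ew neg vw wv)
  qed
  then show ?thesis by blast
qed

text \<open>Pairs are added until there are at least \<open>n\<close> vectors. For odd
  \<open>n\<close> this would give n + 1 of them and an injection from d^(n+1) vectors into d^n, so
  \<open>n\<close> is even and exactly \<open>n\<close> vectors result.\<close>

lemma symplectic_basis:
  fixes d :: nat
  assumes d: "prime d"
    and skew: "\<And>i j. A i j = - A j i"
    and nondeg: "\<forall>v. (\<forall>i<n. [(\<Sum>j<n. A i j * v j) = 0] (mod int d)) \<longrightarrow>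
      (\<forall>j<n. [v j = 0] (mod int d))"
  obtains E where "even n"
    "\<And>i j. i < n \<Longrightarrow> j < n \<Longrightarrow> [bform n A (E i) (E j) = symp_std i j] (mod int d)"
proof -
  \<comment> \<open>The bound lets the last pair overshoot \<open>n\<close> by one, which is the
    case refuted by counting.\<close>
  have k: "2 * k < n + 2 \<Longrightarrow> \<exists>E. \<forall>i<2 * k. \<forall>j<2 * k. [bform n A (E i) (E j) = symp_std i j] (mod int d)" for k
  proof (induction k)
    case (Suc k)
    then obtain E where E: "\<And>i j. i < 2 * k \<Longrightarrow> j < 2 * k \<Longrightarrow> [bform n A (E i) (E j) = symp_std i j] (mod int d)"
      by auto
    have "\<exists>E'. \<forall>i<2 * k + 2. \<forall>j<2 * k + 2. [bform n A (E' i) (E' j) = symp_std i j] (mod int d)"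
      by (rule symplectic_extend[OF d skew nondeg]) (use E Suc.prems in auto)
    then show ?case by simp
  qed simp
  define m where m: "m = 2 * ((n + 1) div 2)"
  have "m < n + 2" using m by linarith
  with k[of "(n + 1) div 2"] obtain E where
    E: "\<And>i j. i < m \<Longrightarrow> j < m \<Longrightarrow> [bform n A (E i) (E j) = symp_std i j] (mod int d)"
    unfolding m by blast
  have d1: "d > 1" using d prime_gt_1_nat by blast
  have "even m" using m by simp
  then have "inj_on (lin_map (int d) m n E) (zd_vecs (int d) m)"
    by (rule lin_map_inj) (use E in auto)
  then have "card (zd_vecs (int d) m) \<le> card (zd_vecs (int d) n)"
    by (rule card_inj_on_le) (use d1 lin_map_zd_vecs finite_zd_vecs in auto)
  then have "m \<le> n" using d1 by (simp add: card_zd_vecs)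
  moreover have "n \<le> m" using m by linarith
  ultimately have "m = n" by simp
  then show ?thesis using that \<open>even m\<close> E by blast
qed

section \<open>Isomorphisms of polar commutator groups\<close>

lemma powi_cong:
  fixes \<omega> :: complex
  assumes "\<omega> ^ d = 1" "d > 0" "[a = b] (mod int d)"
  shows "\<omega> powi a = \<omega> powi b"
proof -
  have "\<omega> \<noteq> 0" using assms(1,2) by (auto simp: power_0_left)
  obtain k where "b = a + int d * k" using assms(3) by (auto simp: cong_iff_lin)
  then have "\<omega> powi b = \<omega> powi a * (\<omega> powi int d) powi k"
    using \<open>\<omega> \<noteq> 0\<close> by (simp add: power_int_add power_int_mult)
  then show ?thesis using assms(1) by simp
qed

lemma vadd_zd_vecs: "d > 0 \<Longrightarrow> vadd d n x y \<in> zd_vecs d n"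
  by (auto simp: vadd_def zd_vecs_def)

lemma vadd_cong: "j < n \<Longrightarrow> [vadd d n x y j = x j + y j] (mod d)"
  by (simp add: vadd_def cong_def)

lemma bform_vadd_left:
  "[bform n W (vadd d n x y) z = bform n W x z + bform n W y z] (mod d)"
  unfolding bform_add_left[symmetric] by (rule bform_cong) (auto simp: vadd_cong)

lemma bform_vadd_right:
  "[bform n W z (vadd d n x y) = bform n W z x + bform n W z y] (mod d)"
  unfolding bform_add_right[symmetric] by (rule bform_cong) (auto simp: vadd_cong)

lemma vadd_assoc: "vadd d n (vadd d n x y) z = vadd d n x (vadd d n y z)"
  by (rule ext) (simp add: vadd_def mod_simps add.assoc)

lemma vadd_zero_left: "x \<in> zd_vecs d n \<Longrightarrow> vadd d n (\<lambda>_. 0) x = x"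
  by (rule ext) (simp add: vadd_def zd_vecs_def)

text \<open>The same extension of \<open>\<int>\<^sub>d\<^sup>n\<close> without splitting the centre \<open>\<complex>\<^sup>\<times>\<close> into \<open>F \<times> \<int>\<^sub>d\<close>.\<close>

definition twisted_grp :: "nat \<Rightarrow> nat \<Rightarrow> complex \<Rightarrow> (nat \<Rightarrow> nat \<Rightarrow> int) \<Rightarrow> (complex \<times> (nat \<Rightarrow> int)) monoid" where
  "twisted_grp d n \<omega> W =
    \<lparr> carrier = {z. z \<noteq> 0} \<times> zd_vecs (int d) n,
      monoid.mult = (\<lambda>g h. (fst g * fst h * \<omega> powi bform n W (snd g) (snd h), vadd (int d) n (snd g) (snd h))),
      one = (1, \<lambda>_. 0) \<rparr>"

lemma twisted_grp_carrier: "(z, x) \<in> carrier (twisted_grp d n \<omega> W) \<longleftrightarrow> z \<noteq> 0 \<and> x \<in> zd_vecs (int d) n"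
  by (simp add: twisted_grp_def)

lemma twisted_grp_mult:
  "(z, x) \<otimes>\<^bsub>twisted_grp d n \<omega> W\<^esub> (w, y) = (z * w * \<omega> powi bform n W x y, vadd (int d) n x y)"
  by (simp add: twisted_grp_def)

lemma twisted_grp_one: "\<one>\<^bsub>twisted_grp d n \<omega> W\<^esub> = (1, \<lambda>_. 0)"
  by (simp add: twisted_grp_def)

lemma group_twisted_grp:
  assumes w: "\<omega> ^ d = 1" "d > 0"
  shows "group (twisted_grp d n \<omega> W)"
proof (rule groupI)
  let ?G = "twisted_grp d n \<omega> W"
  have w0: "\<omega> \<noteq> 0" using w by (auto simp: power_0_left)
  show "g \<otimes>\<^bsub>?G\<^esub> h \<in> carrier ?G" if "g \<in> carrier ?G" "h \<in> carrier ?G" for g h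
    using that w w0 by (cases g; cases h) (simp add: twisted_grp_carrier twisted_grp_mult vadd_zd_vecs)
  show "\<one>\<^bsub>?G\<^esub> \<in> carrier ?G"
    using w by (simp add: twisted_grp_one twisted_grp_carrier zd_vecs_def)
  show "g \<otimes>\<^bsub>?G\<^esub> h \<otimes>\<^bsub>?G\<^esub> k = g \<otimes>\<^bsub>?G\<^esub> (h \<otimes>\<^bsub>?G\<^esub> k)"
    if "g \<in> carrier ?G" "h \<in> carrier ?G" "k \<in> carrier ?G" for g h k
  proof -
    obtain z x z' x' z'' x'' where g: "g = (z, x)" "h = (z', x')" "k = (z'', x'')"
      by (metis surj_pair)
    have "\<omega> powi bform n W (vadd (int d) n x x') x'' = \<omega> powi bform n W x x'' * \<omega> powi bform n W x' x''"
      using powi_cong[OF w bform_vadd_left] w0 by (simp add: power_int_add)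
    moreover have "\<omega> powi bform n W x (vadd (int d) n x' x'') = \<omega> powi bform n W x x' * \<omega> powi bform n W x x''"
      using powi_cong[OF w bform_vadd_right] w0 by (simp add: power_int_add)
    ultimately show ?thesis by (simp add: g twisted_grp_mult vadd_assoc mult_ac)
  qed
  show "\<one>\<^bsub>?G\<^esub> \<otimes>\<^bsub>?G\<^esub> g = g" if "g \<in> carrier ?G" for g
    using that by (cases g)
      (simp add: twisted_grp_one twisted_grp_mult twisted_grp_carrier vadd_zero_left bform_def)
  show "\<exists>h\<in>carrier ?G. h \<otimes>\<^bsub>?G\<^esub> g = \<one>\<^bsub>?G\<^esub>" if g: "g \<in> carrier ?G" for g
  proof -
    obtain z x where gz: "g = (z, x)" by (metis surj_pair)
    define y where "y j = (if j < n then (- x j) mod int d else 0)" for j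
    define v where "v = inverse (z * \<omega> powi bform n W y x)"
    have "z \<noteq> 0" using g by (simp add: gz twisted_grp_carrier)
    then have "v * z * \<omega> powi bform n W y x = 1" "v \<noteq> 0"
      using w0 by (simp_all add: v_def field_simps)
    then have "(v, y) \<in> carrier ?G" "(v, y) \<otimes>\<^bsub>?G\<^esub> g = \<one>\<^bsub>?G\<^esub>"
      using w
      by (simp_all add: gz twisted_grp_carrier twisted_grp_mult twisted_grp_one y_def zd_vecs_def
          vadd_def mod_simps fun_eq_iff)
    then show ?thesis by blast
  qed
qed

text \<open>\<open>iso\<close> speaks only of carriers and multiplication, so the laws can be pulled
  back to a \<open>G\<close> not yet known to be a group. For polar groups this avoids computing
  with the carries \<open>u (a * b)\<close> in associativity and inverses.\<close>

lemma group_of_iso: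
  assumes "group H" and h: "h \<in> iso G H"
    and closed: "\<And>x y. x \<in> carrier G \<Longrightarrow> y \<in> carrier G \<Longrightarrow> x \<otimes>\<^bsub>G\<^esub> y \<in> carrier G"
    and one: "\<one>\<^bsub>G\<^esub> \<in> carrier G" "h \<one>\<^bsub>G\<^esub> = \<one>\<^bsub>H\<^esub>"
  shows "group G"
proof -
  interpret H: group H by fact
  have inj: "x = y" if "h x = h y" "x \<in> carrier G" "y \<in> carrier G" for x y
    using h that by (auto simp: iso_def bij_betw_def inj_on_def)
  have car: "h x \<in> carrier H" if "x \<in> carrier G" for x
    using h that by (auto simp: iso_def hom_def)
  have mult: "h (x \<otimes>\<^bsub>G\<^esub> y) = h x \<otimes>\<^bsub>H\<^esub> h y" if "x \<in> carrier G" "y \<in> carrier G" for x y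
    using h that by (auto simp: iso_def hom_def)
  show ?thesis
  proof (rule groupI)
    fix x y z assume "x \<in> carrier G" "y \<in> carrier G" "z \<in> carrier G"
    then show "x \<otimes>\<^bsub>G\<^esub> y \<otimes>\<^bsub>G\<^esub> z = x \<otimes>\<^bsub>G\<^esub> (y \<otimes>\<^bsub>G\<^esub> z)"
      by (intro inj) (auto simp: closed mult car H.m_assoc)
  next
    fix x assume "x \<in> carrier G"
    then show "\<one>\<^bsub>G\<^esub> \<otimes>\<^bsub>G\<^esub> x = x"
      by (intro inj) (auto simp: closed one mult car)
  next
    fix x assume x: "x \<in> carrier G"
    then have "inv\<^bsub>H\<^esub> (h x) \<in> carrier H" using car by simp
    moreover have "h ` carrier G = carrier H" using h by (simp add: iso_def bij_betw_def)
    ultimately obtain y where y: "y \<in> carrier G" "h y = inv\<^bsub>H\<^esub> (h x)" by (metis imageE)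
    then have "y \<otimes>\<^bsub>G\<^esub> x = \<one>\<^bsub>G\<^esub>"
      using x by (intro inj) (auto simp: closed one mult car)
    with y(1) show "\<exists>y\<in>carrier G. y \<otimes>\<^bsub>G\<^esub> x = \<one>\<^bsub>G\<^esub>" by (intro bexI)
  qed (use closed one in auto)
qed

lemma prim_root_powi_inj:
  assumes w: "prim_root d \<omega>" and pq: "p \<in> {0..<int d}" "q \<in> {0..<int d}"
    and eq: "\<omega> powi p = \<omega> powi q"
  shows "p = q"
proof -
  have *: "q \<le> p" if "p \<in> {0..<int d}" "q \<in> {0..<int d}" "\<omega> powi p = \<omega> powi q" for p q
  proof (rule ccontr)
    assume "\<not> q \<le> p"
    then have k: "0 < nat (q - p)" "nat (q - p) < d" using that by auto
    have "\<omega> \<noteq> 0" using w that by (auto simp: prim_root_def power_0_left)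
    then have "\<omega> powi (q - p) = 1" using that(3) by (simp add: power_int_diff)
    then have "\<omega> ^ nat (q - p) = 1" using k by (simp add: power_int_def split: if_splits)
    then show False using w k by (simp add: prim_root_def)
  qed
  show ?thesis using *[of p q] *[of q p] pq eq by force
qed

section \<open>Polar commutator groups and their normal form\<close>

locale polar_setting =
  fixes d :: nat and \<omega> :: complex and F r u
  assumes d: "prime d" and root: "prim_root d \<omega>"
    and rep: "rep_set \<omega> F" "1 \<in> F"
    and pol: "polar_decomp (int d) \<omega> F r u"
begin

lemma omega_pow: "\<omega> ^ d = 1" using root by (simp add: prim_root_def)

lemma d_pos: "d > 0" using d by (rule prime_gt_0_nat)

lemma omega_nz: "\<omega> \<noteq> 0" using omega_pow d_pos by (auto simp: power_0_left)

lemma powi_mod: "\<omega> powi (k mod int d) = \<omega> powi k"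
  by (rule powi_cong[OF omega_pow d_pos]) simp

lemma polarD:
  assumes "a \<noteq> 0"
  shows "r a \<in> F" "u a \<in> {0..<int d}" "r a * \<omega> powi u a = a"
  using pol assms unfolding polar_decomp_def by auto

lemma F_nz: "a \<in> F \<Longrightarrow> a \<noteq> 0"
  using rep(1) by (auto simp: rep_set_def)

lemma F_unique:
  assumes a: "a \<in> F" and b: "b \<in> F" and p: "p \<in> {0..<int d}" and q: "q \<in> {0..<int d}"
    and eq: "a * \<omega> powi p = b * \<omega> powi q"
  shows "a = b" "p = q"
proof -
  have nz: "a * \<omega> powi p \<noteq> 0" using F_nz[OF a] omega_nz by simp
  have pn: "\<omega> powi p = \<omega> ^ nat p" "\<omega> powi q = \<omega> ^ nat q"
    using p q by (auto simp: power_int_def)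
  have "\<exists>!f. f \<in> F \<and> (\<exists>k::nat. a * \<omega> powi p = f * \<omega> ^ k)"
    using rep(1) nz unfolding rep_set_def by (elim conjE allE impE)
  moreover have "\<exists>k::nat. a * \<omega> powi p = a * \<omega> ^ k" using pn by metis
  moreover have "\<exists>k::nat. a * \<omega> powi p = b * \<omega> ^ k" using pn eq by metis
  ultimately show ab: "a = b" using a b by (metis (no_types))
  show "p = q"
    using prim_root_powi_inj[OF root p q] eq ab F_nz[OF a] by simp
qed

lemma polar_grp_simps:
  "(a, p, x) \<in> carrier (polar_grp (int d) n W F r u) \<longleftrightarrow>
    a \<in> F \<and> p \<in> {0..<int d} \<and> x \<in> zd_vecs (int d) n"
  "(a, p, x) \<otimes>\<^bsub>polar_grp (int d) n W F r u\<^esub> (b, q, y) =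
    (r (a * b), (u (a * b) + p + q + bilin (int d) n W x y) mod int d, vadd (int d) n x y)"
  "\<one>\<^bsub>polar_grp (int d) n W F r u\<^esub> = (1, 0, \<lambda>_. 0)"
  by (simp_all add: polar_grp_def polar_mult_def)

definition unsplit :: "complex \<times> int \<times> (nat \<Rightarrow> int) \<Rightarrow> complex \<times> (nat \<Rightarrow> int)" where
  "unsplit = (\<lambda>(a, p, x). (a * \<omega> powi p, x))"

text \<open>As \<open>r c * \<omega> powi u c = c\<close>, the carry in the second component is
  exactly what makes the scalars multiply as nonzero complex numbers. Bijectivity is existence and
  uniqueness of the polar decomposition.\<close>

lemma unsplit_iso: "unsplit \<in> iso (polar_grp (int d) n W F r u) (twisted_grp d n \<omega> W)"
  (is "_ \<in> iso ?G ?H")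
proof -
  have car: "unsplit g \<in> carrier ?H" if "g \<in> carrier ?G" for g
    using that F_nz omega_nz by (cases g) (auto simp: polar_grp_simps unsplit_def twisted_grp_carrier)
  have hom: "unsplit (g \<otimes>\<^bsub>?G\<^esub> h) = unsplit g \<otimes>\<^bsub>?H\<^esub> unsplit h"
    if gh: "g \<in> carrier ?G" "h \<in> carrier ?G" for g h
  proof -
    obtain a p x b q y where g: "g = (a, p, x)" "h = (b, q, y)" by (metis surj_pair)
    have "a * b \<noteq> 0" using gh F_nz by (auto simp: g polar_grp_simps)
    then have "r (a * b) * \<omega> powi u (a * b) = a * b" by (rule polarD)
    moreover have "\<omega> powi bilin (int d) n W x y = \<omega> powi bform n W x y"
      by (simp add: bilin_eq_bform powi_mod)
    ultimately show ?thesis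
      using omega_nz
      by (simp add: g polar_grp_simps unsplit_def twisted_grp_mult powi_mod power_int_add flip: mult.assoc)
  qed
  have inj: "inj_on unsplit (carrier ?G)"
  proof (rule inj_onI)
    fix g h assume gh: "g \<in> carrier ?G" "h \<in> carrier ?G" "unsplit g = unsplit h"
    obtain a p x b q y where g: "g = (a, p, x)" "h = (b, q, y)" by (metis surj_pair)
    show "g = h" using gh F_unique[of a b p q] by (simp add: g polar_grp_simps unsplit_def)
  qed
  have surj: "unsplit ` carrier ?G = carrier ?H"
  proof (intro equalityI subsetI)
    fix k assume k: "k \<in> carrier ?H"
    obtain z x where kz: "k = (z, x)" by (metis surj_pair)
    then have "z \<noteq> 0" "x \<in> zd_vecs (int d) n" using k by (auto simp: twisted_grp_carrier)
    then have "(r z, u z, x) \<in> carrier ?G" "unsplit (r z, u z, x) = k"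
      using polarD[of z] by (auto simp: polar_grp_simps unsplit_def kz)
    then show "k \<in> unsplit ` carrier ?G" by (metis imageI)
  qed (use car in auto)
  show ?thesis unfolding iso_def hom_def bij_betw_def using car hom inj surj by auto
qed

lemma group_polar_grp: "group (polar_grp (int d) n W F r u)"
proof (rule group_of_iso[OF group_twisted_grp[OF omega_pow d_pos] unsplit_iso])
  let ?G = "polar_grp (int d) n W F r u"
  fix g h assume gh: "g \<in> carrier ?G" "h \<in> carrier ?G"
  obtain a p x b q y where g: "g = (a, p, x)" "h = (b, q, y)" by (metis surj_pair)
  have "a * b \<noteq> 0" using gh F_nz by (auto simp: g polar_grp_simps)
  then show "g \<otimes>\<^bsub>?G\<^esub> h \<in> carrier ?G"
    using polarD(1) d_pos vadd_zd_vecs by (simp add: g polar_grp_simps)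
next
  show "\<one>\<^bsub>polar_grp (int d) n W F r u\<^esub> \<in> carrier (polar_grp (int d) n W F r u)"
    using rep(2) d_pos by (simp add: polar_grp_simps zd_vecs_def)
next
  show "unsplit \<one>\<^bsub>polar_grp (int d) n W F r u\<^esub> = \<one>\<^bsub>twisted_grp d n \<omega> W\<^esub>"
    by (simp add: polar_grp_simps unsplit_def twisted_grp_one)
qed

text \<open>For odd \<open>d = 2 * k + 1\<close> the power \<open>\<omega> ^ (k + 1)\<close> is a
  square root. For \<open>d = 2\<close> no square root lies among the powers of
  \<open>\<omega>\<close>, and a primitive fourth root of unity is taken.\<close>

lemma sqrt_root:
  obtains \<zeta> :: complex where "\<zeta>\<^sup>2 = \<omega>" "\<zeta> ^ (d * d) = 1"
proof (cases "d = 2")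
  case True
  have "csqrt \<omega> ^ (2 * 2) = ((csqrt \<omega>)\<^sup>2)\<^sup>2" by (rule power_mult)
  also have "\<dots> = 1" using omega_pow True by simp
  finally show ?thesis using that[of "csqrt \<omega>"] True by simp
next
  case False
  then have "odd d" using d primes_dvd_imp_eq two_is_prime_nat by blast
  then obtain k where k: "d = 2 * k + 1" by (elim oddE)
  have "(\<omega> ^ (k + 1))\<^sup>2 = \<omega> ^ d * \<omega>"
    by (simp add: k power2_eq_square power_add power_mult mult_ac)
  moreover have "(\<omega> ^ (k + 1)) ^ (d * d) = (\<omega> ^ d) ^ ((k + 1) * d)"
    unfolding power_mult[symmetric] by (simp only: mult_ac)
  ultimately show ?thesis using that[of "\<omega> ^ (k + 1)"] omega_pow by simp
qed

text \<open>Over \<open>\<complex>\<^sup>\<times>\<close> the symmetric bicharacter \<open>\<omega> ^ D(x, y)\<close> is the coboundary of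
  \<open>\<zeta> ^ D(x, x)\<close>; the condition \<open>\<zeta> ^ (d * d) = 1\<close> makes this well defined modulo \<open>d\<close>,
  also for \<open>d = 2\<close>, where \<open>\<zeta> = \<plusminus>\<i>\<close>.\<close>

lemma quadratic_vadd:
  assumes z: "\<zeta>\<^sup>2 = \<omega>" "\<zeta> ^ (d * d) = 1"
    and sym: "\<And>i j. i < n \<Longrightarrow> j < n \<Longrightarrow> D i j = D j i"
  shows "\<zeta> powi bform n D (vadd (int d) n x y) (vadd (int d) n x y) =
    \<zeta> powi bform n D x x * \<zeta> powi bform n D y y * \<omega> powi bform n D x y"
proof -
  have z0: "\<zeta> \<noteq> 0" using z(1) omega_nz by auto
  have symm: "bform n D b a = bform n D a b" for a b
    unfolding bform_transpose[of n D b a] using sym by (auto simp: bform_def intro!: sum.cong)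
  have z2: "\<zeta> powi (2 * k) = \<omega> powi k" for k
    using z(1) by (simp add: power_int_mult)
  define s where "s j = x j + y j" for j
  \<comment> \<open>The carry of the reduction: below \<open>n\<close> the entries of
    \<open>vadd\<close> are \<open>s j + d * e j\<close>. The sum over \<open>{()}\<close> lets the
    lemmas on sums extract the factor \<open>d\<close>.\<close>
  define e where "e j = - (s j div int d)" for j
  let ?v = "\<lambda>j. s j + (\<Sum>i\<in>{()}. int d * e j)"
  have "bform n D (vadd (int d) n x y) (vadd (int d) n x y) = bform n D ?v ?v"
    unfolding bform_def by (intro sum.cong refl)
      (simp add: vadd_def s_def e_def minus_div_mult_eq_mod[symmetric] algebra_simps)
  also have "\<dots> = bform n D s s + int d * bform n D s e + int d * bform n D e s
      + int d * int d * bform n D e e"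
    using bform_sum_left[of n D "\<lambda>_. int d" "\<lambda>_. e" "{()}"]
      bform_sum_right[of n D _ "\<lambda>_. int d" "\<lambda>_. e" "{()}"]
    by (simp add: bform_add_left bform_add_right algebra_simps)
  \<comment> \<open>By symmetry the mixed terms acquire the factor \<open>2 * d\<close>, where
    \<open>\<zeta>\<close> contributes a power of \<open>\<omega> ^ d = 1\<close>; the last term is
    removed by \<open>\<zeta> ^ (d * d) = 1\<close>.\<close>
  also have "\<dots> = bform n D s s + 2 * (int d * bform n D s e) + int (d * d) * bform n D e e"
    by (simp add: symm[of e s])
  also have "\<zeta> powi \<dots> = \<zeta> powi bform n D s s * (\<omega> powi int d) powi bform n D s e
      * (\<zeta> powi int (d * d)) powi bform n D e e"
    using z0 by (simp only: power_int_add z2 simp_thms) (simp only: power_int_mult)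
  also have "\<dots> = \<zeta> powi bform n D s s" using omega_pow z(2) by (simp del: of_nat_mult)
  also have "bform n D s s = bform n D x x + bform n D y y + 2 * bform n D x y"
    by (simp add: s_def[abs_def] bform_add_left bform_add_right symm[of y x])
  finally show ?thesis using z0 by (simp only: power_int_add z2 simp_thms)
qed

text \<open>All nondegenerate \<open>W\<close> share the model \<open>symp_half\<close>: a
  symplectic basis gives a linear change of coordinates, and the symmetric remainder is absorbed by
  rescaling the scalars.\<close>

lemma twisted_grp_std_iso:
  assumes W: "full_rank_mod (int d) n (Omega (int d) W)"
  shows "\<exists>\<psi>. \<psi> \<in> iso (twisted_grp d n \<omega> symp_half) (twisted_grp d n \<omega> W)"
proof -
  let ?G = "twisted_grp d n \<omega> symp_half" and ?H = "twisted_grp d n \<omega> W"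
  \<comment> \<open>The unreduced version of \<open>Omega\<close>, so that skewness is
    exact.\<close>
  define A where "A i j = W i j - W j i" for i j
  have A: "bform n A x y = bform n W x y - bform n W y x" for x y
    unfolding A_def[abs_def] bform_mat_diff bform_transpose[of n W y x] ..
  have nondeg: "\<forall>v. (\<forall>i<n. [(\<Sum>j<n. A i j * v j) = 0] (mod int d)) \<longrightarrow>
      (\<forall>j<n. [v j = 0] (mod int d))"
  proof (intro allI impI)
    fix v j assume v: "\<forall>i<n. [(\<Sum>j<n. A i j * v j) = 0] (mod int d)" and j: "j < n"
    define x where "x j = (if j < n then v j mod int d else 0)" for j
    have x: "x \<in> zd_vecs (int d) n" using d_pos by (auto simp: x_def zd_vecs_def)
    have "(\<Sum>j<n. Omega (int d) W i j * x j) mod int d = 0" if i: "i < n" for i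
    proof -
      have "[(\<Sum>j<n. Omega (int d) W i j * x j) = (\<Sum>j<n. A i j * v j)] (mod int d)"
        by (intro cong_sum cong_mult) (auto simp: Omega_def A_def x_def)
      with v i show ?thesis by (auto simp: cong_def)
    qed
    then have "\<forall>i<n. (\<Sum>j<n. Omega (int d) W i j * x j) mod int d = 0" by (intro allI impI)
    then have "\<forall>j<n. x j = 0" by (rule mp[OF bspec[OF W[unfolded full_rank_mod_def] x]])
    then have "x j = 0" using j by simp
    then show "[v j = 0] (mod int d)" using j by (simp add: x_def cong_def)
  qed
  have skew: "A i j = - A j i" for i j by (simp add: A_def)
  obtain E where n: "even n"
    and E: "\<And>i j. i < n \<Longrightarrow> j < n \<Longrightarrow> [bform n A (E i) (E j) = symp_std i j] (mod int d)"
    by (rule symplectic_basis[OF d skew nondeg]) auto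
  define L where "L = lin_map (int d) n n E"
  define C where "C i j = bform n W (E i) (E j)" for i j
  \<comment> \<open>\<open>C - symp_half\<close> is symmetric only modulo \<open>d\<close>;
    reduction gives the equality that \<open>quadratic_vadd\<close> asks for.\<close>
  define D where "D i j = (C i j - symp_half i j) mod int d" for i j
  have symD: "D i j = D j i" if "i < n" "j < n" for i j
  proof -
    have "[C i j - C j i = symp_half i j - symp_half j i] (mod int d)"
      using E[OF that] by (simp add: A C_def symp_std_def)
    then have "[C i j - symp_half i j = C j i - symp_half j i] (mod int d)"
      by (simp add: cong_iff_dvd_diff algebra_simps)
    then show ?thesis by (simp add: D_def cong_def)
  qed
  have LL: "[bform n W (L x) (L y) = bform n symp_half x y + bform n D x y] (mod int d)" for x y
  proof -
    have "[bform n W (L x) (L y) = bform n W (\<lambda>j. \<Sum>i<n. x i * E i j) (\<lambda>j. \<Sum>i<n. y i * E i j)] (mod int d)"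
      by (rule bform_cong) (auto simp: L_def lin_map_def)
    also have "bform n W (\<lambda>j. \<Sum>i<n. x i * E i j) (\<lambda>j. \<Sum>i<n. y i * E i j) = bform n C x y"
      unfolding bform_sum_left bform_sum_right
      by (simp add: bform_def[of n C] C_def sum_distrib_left mult_ac)
    also have "bform n C x y = bform n symp_half x y + bform n (\<lambda>i j. C i j - symp_half i j) x y"
      unfolding bform_mat_diff by simp
    also have "[\<dots> = bform n symp_half x y + bform n D x y] (mod int d)"
      by (intro cong_add bform_cong) (auto simp: D_def cong_def)
    finally show ?thesis .
  qed
  have Lzd: "L x \<in> zd_vecs (int d) n" for x using d_pos by (simp add: L_def lin_map_zd_vecs)
  have Linj: "inj_on L (zd_vecs (int d) n)" unfolding L_def by (rule lin_map_inj[OF n E])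
  have Lsurj: "L ` zd_vecs (int d) n = zd_vecs (int d) n"
    by (rule endo_inj_surj[OF finite_zd_vecs _ Linj]) (use Lzd in auto)
  have Ladd: "L (vadd (int d) n x y) = vadd (int d) n (L x) (L y)" for x y
  proof (rule zd_vecs_cong_eq[OF Lzd vadd_zd_vecs])
    fix j assume j: "j < n"
    have "[L (vadd (int d) n x y) j = (\<Sum>i<n. vadd (int d) n x y i * E i j)] (mod int d)"
      using j by (simp add: L_def lin_map_def)
    also have "[(\<Sum>i<n. vadd (int d) n x y i * E i j) = (\<Sum>i<n. (x i + y i) * E i j)] (mod int d)"
      by (intro cong_sum cong_mult) (auto simp: vadd_cong)
    also have "(\<Sum>i<n. (x i + y i) * E i j) = (\<Sum>i<n. x i * E i j) + (\<Sum>i<n. y i * E i j)"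
      by (simp add: distrib_right sum.distrib)
    also have "[\<dots> = L x j + L y j] (mod int d)"
      using j by (intro cong_add) (auto simp: L_def lin_map_def cong_def)
    also have "[L x j + L y j = vadd (int d) n (L x) (L y) j] (mod int d)"
      using vadd_cong[OF j] by (rule cong_sym)
    finally show "[L (vadd (int d) n x y) j = vadd (int d) n (L x) (L y) j] (mod int d)" .
  qed (use d_pos in simp)
  obtain \<zeta> where z: "\<zeta>\<^sup>2 = \<omega>" "\<zeta> ^ (d * d) = 1" by (rule sqrt_root)
  have z0: "\<zeta> \<noteq> 0" using z(1) omega_nz by auto
  \<comment> \<open>The power of \<open>\<zeta>\<close> is the cochain whose coboundary supplies the
    \<open>D\<close> term in \<open>LL\<close>.\<close>
  define \<psi> where "\<psi> = (\<lambda>(c, x). (c * \<zeta> powi bform n D x x, L x))"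
  have car: "\<psi> g \<in> carrier ?H" if "g \<in> carrier ?G" for g
    using that z0 Lzd by (cases g) (simp add: \<psi>_def twisted_grp_carrier)
  have hom: "\<psi> (g \<otimes>\<^bsub>?G\<^esub> h) = \<psi> g \<otimes>\<^bsub>?H\<^esub> \<psi> h" for g h
  proof -
    obtain c x c' y where g: "g = (c, x)" "h = (c', y)" by (metis surj_pair)
    have "\<omega> powi bform n W (L x) (L y) = \<omega> powi bform n symp_half x y * \<omega> powi bform n D x y"
      using powi_cong[OF omega_pow d_pos LL[of x y]] omega_nz by (simp add: power_int_add)
    moreover have "\<zeta> powi bform n D (vadd (int d) n x y) (vadd (int d) n x y) =
        \<zeta> powi bform n D x x * \<zeta> powi bform n D y y * \<omega> powi bform n D x y"
      by (rule quadratic_vadd[OF z symD])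
    ultimately show ?thesis
      by (simp add: g \<psi>_def twisted_grp_mult Ladd mult_ac)
  qed
  have inj: "inj_on \<psi> (carrier ?G)"
  proof (rule inj_onI)
    fix g h assume gh: "g \<in> carrier ?G" "h \<in> carrier ?G" "\<psi> g = \<psi> h"
    obtain c x c' y where g: "g = (c, x)" "h = (c', y)" by (metis surj_pair)
    have "x = y" using gh inj_onD[OF Linj, of x y] by (simp add: g \<psi>_def twisted_grp_carrier)
    then show "g = h" using gh z0 by (simp add: g \<psi>_def)
  qed
  have surj: "\<psi> ` carrier ?G = carrier ?H"
  proof (intro equalityI subsetI)
    fix k assume k: "k \<in> carrier ?H"
    obtain c y where ky: "k = (c, y)" by (metis surj_pair)
    then have c: "c \<noteq> 0" and "y \<in> zd_vecs (int d) n" using k by (auto simp: twisted_grp_carrier)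
    then obtain x where x: "x \<in> zd_vecs (int d) n" "y = L x" using Lsurj by (metis imageE)
    then have "(c / \<zeta> powi bform n D x x, x) \<in> carrier ?G" "\<psi> (c / \<zeta> powi bform n D x x, x) = k"
      using c z0 by (auto simp: twisted_grp_carrier \<psi>_def ky)
    then show "k \<in> \<psi> ` carrier ?G" by (metis imageI)
  qed (use car in auto)
  have "\<psi> \<in> iso ?G ?H" unfolding iso_def hom_def bij_betw_def using car hom inj surj by auto
  then show ?thesis by (intro exI[of _ \<psi>])
qed

text \<open>Both groups are compared with the extension for \<open>symp_half\<close>, after merging
  the centre by \<open>unsplit\<close>.\<close>

lemma polar_grp_iso:
  assumes "full_rank_mod (int d) n (Omega (int d) W1)" "full_rank_mod (int d) n (Omega (int d) W2)"
  shows "\<exists>\<phi>. \<phi> \<in> iso (polar_grp (int d) n W1 F r u) (polar_grp (int d) n W2 F r u)"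
proof -
  obtain \<psi>1 \<psi>2 where p: "\<psi>1 \<in> iso (twisted_grp d n \<omega> symp_half) (twisted_grp d n \<omega> W1)"
    "\<psi>2 \<in> iso (twisted_grp d n \<omega> symp_half) (twisted_grp d n \<omega> W2)"
    using assms[THEN twisted_grp_std_iso] by blast
  note 1 = group.iso_set_sym[OF group_twisted_grp[OF omega_pow d_pos] p(1)]
  note 2 = group.iso_set_sym[OF group_polar_grp unsplit_iso[of n W2]]
  show ?thesis
    using iso_set_trans[OF iso_set_trans[OF iso_set_trans[OF unsplit_iso 1] p(2)] 2] by blast
qed

end

section \<open>From equal characters to the unitary intertwiner\<close>

lemma unitary_mat_adjoint_eq:
  assumes U: "unitary_mat A" and A: "A \<in> carrier_mat N N" and B: "B \<in> carrier_mat N N"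
    and AB: "A * B = 1\<^sub>m N"
  shows "mat_adjoint A = B"
proof -
  have aA: "mat_adjoint A \<in> carrier_mat N N" using A by simp
  have "mat_adjoint A * A = 1\<^sub>m N" using U A by (simp add: unitary_mat_def)
  then have "B = (mat_adjoint A * A) * B" using B by simp
  also have "\<dots> = mat_adjoint A * (A * B)" by (rule assoc_mult_mat[OF aA A B])
  also have "\<dots> = mat_adjoint A" using AB right_mult_one_mat[OF aA] by simp
  finally show ?thesis by simp
qed

lemma mat_trace_one: "mat_trace (1\<^sub>m N) = of_nat N"
  by (simp add: mat_trace_def)

theorem theorem2:
  fixes d :: nat and n N1 N2 :: nat and \<omega> :: complex
    and F :: "complex set" and r :: "complex \<Rightarrow> complex" and u :: "complex \<Rightarrow> int"
    and W1 W2 :: "nat \<Rightarrow> nat \<Rightarrow> int"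
    and \<tau>1 \<tau>2 :: "(nat \<Rightarrow> int) \<Rightarrow> complex mat"
  defines "G1 \<equiv> polar_grp (int d) n W1 F r u"
    and "G2 \<equiv> polar_grp (int d) n W2 F r u"
    and "\<mu>1 \<equiv> pcr_map \<omega> \<tau>1"
    and "\<mu>2 \<equiv> pcr_map \<omega> \<tau>2"
  assumes "prime d"
    and "prim_root d \<omega>"
    and "rep_set \<omega> F" and "1 \<in> F"
    and "polar_decomp (int d) \<omega> F r u"
    and "W1 \<in> zd_mats (int d) n" and "W2 \<in> zd_mats (int d) n"
    and "polar_comm_rep (int d) n W1 F r u \<omega> N1 \<tau>1"
    and "polar_comm_rep (int d) n W2 F r u \<omega> N2 \<tau>2"
    and "full_rank_mod (int d) n (Omega (int d) W1)"
    and "full_rank_mod (int d) n (Omega (int d) W2)"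
  shows "(\<exists>\<phi>. \<phi> \<in> iso G1 G2) \<and>
    (\<forall>\<phi> \<in> iso G1 G2.
      (\<forall>g\<in>carrier G1. mat_trace (\<mu>1 g) = mat_trace (\<mu>2 (\<phi> g))) \<and>
      (\<exists>B \<subseteq> carrier G1. spans_mat N1 (\<mu>1 ` B) \<and>
         ((\<forall>g\<in>B. hermitian_mat (\<mu>1 g) \<and> hermitian_mat (\<mu>2 (\<phi> g))) \<or>
          (\<forall>g\<in>B. unitary_mat (\<mu>1 g) \<and> unitary_mat (\<mu>2 (\<phi> g)))))
      \<longrightarrow> N1 = N2 \<and>
          (\<exists>S \<in> carrier_mat N1 N1. unitary_mat S \<and>
             (\<forall>g\<in>carrier G1. \<mu>2 (\<phi> g) = S * \<mu>1 g * mat_adjoint S)))"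
proof -
  interpret polar_setting d \<omega> F r u by unfold_locales fact+
  interpret G1: group G1 unfolding G1_def by (rule group_polar_grp)
  have mu1: "\<mu>1 \<in> hom G1 (GL_mat N1)" and inj1: "inj_on \<mu>1 (carrier G1)"
    and mu2: "\<mu>2 \<in> hom G2 (GL_mat N2)"
    using \<open>polar_comm_rep (int d) n W1 F r u \<omega> N1 \<tau>1\<close> \<open>polar_comm_rep (int d) n W2 F r u \<omega> N2 \<tau>2\<close>
    unfolding polar_comm_rep_def G1_def G2_def \<mu>1_def \<mu>2_def by simp_all
  \<comment> \<open>In dimension zero all matrices coincide, whereas the central elements with
    second component \<open>0\<close> and \<open>1\<close> differ because \<open>d > 1\<close>;
    injectivity excludes this.\<close>
  have N1: "N1 > 0"
  proof (rule ccontr)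
    assume "\<not> N1 > 0"
    then have "\<mu>1 g = \<mu>1 h" if "g \<in> carrier G1" "h \<in> carrier G1" for g h
      using hom_in_carrier[OF mu1 that(1)] hom_in_carrier[OF mu1 that(2)]
      by (intro eq_matI) (auto simp: GL_mat_def)
    then have "(1, 0, \<lambda>_. 0) = (1 :: complex, 1 :: int, \<lambda>_ :: nat. 0 :: int)"
      using prime_gt_1_nat[OF d] rep(2)
      by (intro inj_onD[OF inj1]) (auto simp: G1_def polar_grp_simps zd_vecs_def)
    then show False by simp
  qed
  have "N1 = N2 \<and> (\<exists>S \<in> carrier_mat N1 N1. unitary_mat S \<and>
      (\<forall>g\<in>carrier G1. \<mu>2 (\<phi> g) = S * \<mu>1 g * mat_adjoint S))"
    if phi: "\<phi> \<in> iso G1 G2"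
      and chi: "\<And>g. g \<in> carrier G1 \<Longrightarrow> mat_trace (\<mu>1 g) = mat_trace (\<mu>2 (\<phi> g))"
      and B: "B \<subseteq> carrier G1" and sp: "spans_mat N1 (\<mu>1 ` B)"
      and hu: "(\<forall>g\<in>B. hermitian_mat (\<mu>1 g) \<and> hermitian_mat (\<mu>2 (\<phi> g))) \<or>
          (\<forall>g\<in>B. unitary_mat (\<mu>1 g) \<and> unitary_mat (\<mu>2 (\<phi> g)))" for \<phi> B
  proof -
    define \<rho> where "\<rho> g = \<mu>2 (\<phi> g)" for g
    have rho2: "\<rho> \<in> hom G1 (GL_mat N2)"
      using hom_compose[of \<phi> G1 G2 \<mu>2] phi mu2 by (simp add: iso_def \<rho>_def[abs_def] comp_def)
    \<comment> \<open>The character at the identity is the dimension.\<close>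
    have "mat_trace (\<mu>1 \<one>\<^bsub>G1\<^esub>) = mat_trace (\<rho> \<one>\<^bsub>G1\<^esub>)" by (simp add: chi \<rho>_def)
    then have N: "N1 = N2"
      using hom_one[OF mu1 G1.is_group group_GL_mat] hom_one[OF rho2 G1.is_group group_GL_mat]
      by (simp add: GL_mat_simps mat_trace_one)
    have rho: "\<rho> \<in> hom G1 (GL_mat N1)" using rho2 N by simp
    \<comment> \<open>The adjoint of a unitary value is its inverse, which is the value at the
      inverse group element.\<close>
    have star: "mat_adjoint (f g) = f (inv\<^bsub>G1\<^esub> g)"
      if f: "f \<in> hom G1 (GL_mat N1)" and g: "g \<in> carrier G1" and U: "unitary_mat (f g)" for f g
    proof (rule unitary_mat_adjoint_eq[OF U, of N1])
      show "f g \<in> carrier_mat N1 N1" "f (inv\<^bsub>G1\<^esub> g) \<in> carrier_mat N1 N1"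
        using hom_in_carrier[OF f g] hom_in_carrier[OF f G1.inv_closed[OF g]]
        by (simp_all add: GL_mat_def)
      have "f g * f (inv\<^bsub>G1\<^esub> g) = f (g \<otimes>\<^bsub>G1\<^esub> inv\<^bsub>G1\<^esub> g)"
        using hom_mult[OF f g G1.inv_closed[OF g]] by (simp add: GL_mat_simps)
      then show "f g * f (inv\<^bsub>G1\<^esub> g) = 1\<^sub>m N1"
        using hom_one[OF f G1.is_group group_GL_mat] g by (simp add: GL_mat_simps)
    qed
    have "\<exists>st. \<forall>g\<in>B. st g \<in> carrier G1 \<and> mat_adjoint (\<mu>1 g) = \<mu>1 (st g) \<and> mat_adjoint (\<rho> g) = \<rho> (st g)"
      using hu
    proof
      assume "\<forall>g\<in>B. hermitian_mat (\<mu>1 g) \<and> hermitian_mat (\<mu>2 (\<phi> g))"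
      then show ?thesis
        using B by (intro exI[of _ "\<lambda>g. g"]) (auto simp: hermitian_mat_def \<rho>_def)
    next
      assume "\<forall>g\<in>B. unitary_mat (\<mu>1 g) \<and> unitary_mat (\<mu>2 (\<phi> g))"
      then show ?thesis
        using B star[OF mu1] star[OF rho] by (intro exI[of _ "\<lambda>g. inv\<^bsub>G1\<^esub> g"]) (auto simp: \<rho>_def)
    qed
    then obtain st where st: "\<forall>g\<in>B. st g \<in> carrier G1 \<and> mat_adjoint (\<mu>1 g) = \<mu>1 (st g) \<and>
        mat_adjoint (\<rho> g) = \<rho> (st g)" ..
    have "\<exists>S \<in> carrier_mat N1 N1. unitary_mat S \<and> (\<forall>g\<in>carrier G1. \<rho> g = S * \<mu>1 g * mat_adjoint S)"
      by (rule unitary_equivalence_of_characters[OF G1.is_group N1 mu1 rho _ B sp, of st])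
        (use chi st in \<open>auto simp: \<rho>_def\<close>)
    then show ?thesis using N by (simp add: \<rho>_def)
  qed
  moreover have "\<exists>\<phi>. \<phi> \<in> iso G1 G2"
    unfolding G1_def G2_def by (rule polar_grp_iso) fact+
  ultimately show ?thesis by (intro conjI ballI impI) (elim conjE exE; blast)+
qed

end
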